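(* Let $k\in\{2,3,4,5,6\}$ and let $n$ be any positive integer. Define $\ell:=\lfloor (k+1)^2/4\rfloor$ and $q:=n \bmod \ell$. Then \[ \nu_k(K_{k+1,n}) = q\binom{\frac{n-q}{\ell}+1}{2} + (\ell-q)\binom{\frac{n-q}{\ell}}{2}. \]
   Context: A book with $k$ pages consists of a line (the spine) and $k$ half-planes (the pages) whose common boundary is the spine. A $k$-page drawing of a graph places all vertices on the spine and draws each edge inside a single page (edges may cross). The $k$-page crossing number $\nu_k(G)$ is the minimum number of crossings over all $k$-page drawings of $G$. Convention: $\binom{a}{b}=0$ whenever $a<b$. *)

theory Defs
  imports Main
begin

text \<open>Combinatorial model of k-page book drawings of the complete bipartite graph K_{m,n}.
  Vertices: Inl i (i < m) and Inr j (j < n). Edge (i,j) joins Inl i and Inr j.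
  A drawing is given by an injective placement of the vertices on the spine (pos)
  and an assignment of each edge to one of the pages 0..k-1 (pg).
  Two edges on the same page must cross (once, in an optimal drawing) exactly when
  their endpoints interleave along the spine; otherwise they can be drawn disjointly.\<close>

definition interleave :: "nat \<Rightarrow> nat \<Rightarrow> nat \<Rightarrow> nat \<Rightarrow> bool" where
  "interleave a b c d =
     (let x1 = min a b; x2 = max a b; y1 = min c d; y2 = max c d in
       (x1 < y1 \<and> y1 < x2 \<and> x2 < y2) \<or> (y1 < x1 \<and> x1 < y2 \<and> y2 < x2))"

definition kmn_vertices :: "nat \<Rightarrow> nat \<Rightarrow> (nat + nat) set" where
  "kmn_vertices m n = Inl ` {..<m} \<union> Inr ` {..<n}"

definition kmn_edges :: "nat \<Rightarrow> nat \<Rightarrow> (nat \<times> nat) set" where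
  "kmn_edges m n = {..<m} \<times> {..<n}"

definition edge_cross :: "(nat + nat \<Rightarrow> nat) \<Rightarrow> nat \<times> nat \<Rightarrow> nat \<times> nat \<Rightarrow> bool" where
  "edge_cross pos e f =
     interleave (pos (Inl (fst e))) (pos (Inr (snd e))) (pos (Inl (fst f))) (pos (Inr (snd f)))"

definition crossings ::
  "nat \<Rightarrow> nat \<Rightarrow> (nat + nat \<Rightarrow> nat) \<Rightarrow> (nat \<times> nat \<Rightarrow> nat) \<Rightarrow> nat" where
  "crossings m n pos pg =
     card {{e, f} | e f. e \<in> kmn_edges m n \<and> f \<in> kmn_edges m n \<and> pg e = pg f \<and> edge_cross pos e f}"

definition k_page_drawing ::
  "nat \<Rightarrow> nat \<Rightarrow> nat \<Rightarrow> (nat + nat \<Rightarrow> nat) \<Rightarrow> (nat \<times> nat \<Rightarrow> nat) \<Rightarrow> bool" where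
  "k_page_drawing k m n pos pg =
     (inj_on pos (kmn_vertices m n) \<and> (\<forall>e \<in> kmn_edges m n. pg e < k))"

definition book_crossing_Kmn :: "nat \<Rightarrow> nat \<Rightarrow> nat \<Rightarrow> nat" where
  "book_crossing_Kmn k m n =
     (LEAST c. \<exists>pos pg. k_page_drawing k m n pos pg \<and> crossings m n pos pg = c)"

end

theory Submission
  imports Defs "HOL-Library.Sublist"
begin

text \<open>
  Join two blue vertices (the ones of degree \<open>k + 1\<close>) when their stars cross. If no \<open>l + 1\<close> stars can
  be drawn without crossings, then every set of \<open>l + 1\<close> blue vertices contains a joined pair, and
  Turan's theorem for the complement bounds the number of crossings from below by
  \<open>\<Sum>i<n. i div l\<close>, which is the claimed value. For the upper bound, \<open>l\<close> stars can be drawn without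
  crossings such that each blue vertex has two edges on one page and one edge on every other page.
  Replacing a blue vertex by a cluster of clones then costs one crossing per pair of clones.

  It remains to see that \<open>K\<^sub>k\<^sub>+\<^sub>1\<^sub>,\<^sub>l\<^sub>+\<^sub>1\<close> has no \<open>k\<close>-page embedding for \<open>k \<le> 6\<close>. Up to rotation, the order
  of the vertices along the spine is described by the numbers of blue vertices in the \<open>k + 1\<close> gaps
  between the red ones. Each such gap list dominates, up to rotation and reflection, one of a few
  cores, and each core is excluded by linear programming duality: there is a set \<open>F\<close> of edges such
  that \<open>card F > k * W\<close>, where \<open>W\<close> is the largest number of pairwise noncrossing edges of \<open>F\<close>.
\<close>

section \<open>Graphs without large independent sets\<close>

text \<open>Shifting the index by \<open>l\<close> raises every quotient by one, and the first
  \<open>l\<close> quotients vanish.\<close>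

lemma sum_div_add:
  fixes l :: nat
  assumes "l > 0"
  shows "(\<Sum>i<n + l. i div l) = (\<Sum>i<n. i div l) + n"
proof (induction n)
  case 0
  then show ?case by simp
next
  case (Suc n)
  then show ?case using assms by (simp add: div_add_self2)
qed

text \<open>Each residue class modulo \<open>l\<close> contributes a sum
  \<open>0 + 1 + 2 + ...\<close>, hence a binomial coefficient; \<open>n mod l\<close> of the
  classes have \<open>n div l + 1\<close> members below \<open>n\<close>, the others
  \<open>n div l\<close>.\<close>

lemma sum_div_eq_choose:
  fixes l :: nat
  assumes "l > 0"
  shows "(\<Sum>i<n. i div l) =
    (n mod l) * ((n div l + 1) choose 2) + (l - n mod l) * ((n div l) choose 2)"
proof (induction n)
  case 0
  then show ?case by (simp add: choose_two)
next
  case (Suc n)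
  define s q where "s = n div l" and "q = n mod l"
  have q: "q < l" using assms by (simp add: q_def)
  have c2: "Suc x choose 2 = (x choose 2) + x" for x
    by (simp add: numeral_2_eq_2)
  have step: "(\<Sum>i<Suc n. i div l) = q * (Suc s choose 2) + (l - q) * (s choose 2) + s"
    using Suc by (simp add: s_def q_def)
  show ?case
  proof (cases "Suc q = l")
    case True
    then have *: "Suc n mod l = 0" "Suc n div l = Suc s"
      by (simp_all add: q_def s_def mod_Suc div_Suc)
    have "l - q = 1" using True by linarith
    then have "(\<Sum>i<Suc n. i div l) = Suc q * (Suc s choose 2)"
      unfolding step by (simp add: c2[of s])
    then show ?thesis using * True by simp
  next
    case False
    then have *: "Suc n mod l = Suc q" "Suc n div l = s"
      by (simp_all add: q_def s_def mod_Suc div_Suc)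
    have "l - q = Suc (l - Suc q)" using q False by linarith
    then have "(\<Sum>i<Suc n. i div l) = Suc q * (Suc s choose 2) + (l - Suc q) * (s choose 2)"
      unfolding step by (simp add: c2[of s])
    then show ?thesis using * by simp
  qed
qed

text \<open>Equality holds for \<open>i = l\<close> by \<open>sum_div_add\<close>, and a smaller
  \<open>i\<close> only enlarges the right-hand side. It is the arithmetic of removing an
  independent set of size \<open>i\<close> in Turan's theorem.\<close>

lemma sum_div_diff_le:
  fixes l :: nat
  assumes "i \<le> l" "i \<le> n"
  shows "(\<Sum>j<n. j div l) \<le> (\<Sum>j<n - i. j div l) + (n - i)"
proof (cases "n \<le> l \<or> l = 0")
  \<comment> \<open>All quotients vanish here; for \<open>l = 0\<close> because
    \<open>j div 0 = 0\<close>.\<close>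
  case True
  then have "(\<Sum>j<n. j div l) = 0" by auto
  then show ?thesis by simp
next
  case False
  then have "(\<Sum>j<n. j div l) = (\<Sum>j<n - l. j div l) + (n - l)"
    using sum_div_add[of l "n - l"] by simp
  also have "\<dots> \<le> (\<Sum>j<n - i. j div l) + (n - i)"
    using assms by (intro add_mono sum_mono2) auto
  finally show ?thesis .
qed

text \<open>Turan's theorem for the complement graph: remove a largest independent set \<open>I\<close>;
  every other vertex is joined to a vertex of \<open>I\<close>.\<close>

lemma edges_ge_if_independent_sets_small:
  fixes adj :: "'a \<Rightarrow> 'a \<Rightarrow> bool"
  assumes "finite V"
    and sym: "\<And>x y. adj x y \<Longrightarrow> adj y x"
    and small: "\<And>I. I \<subseteq> V \<Longrightarrow> (\<And>x y. x \<in> I \<Longrightarrow> y \<in> I \<Longrightarrow> x \<noteq> y \<Longrightarrow> \<not> adj x y) \<Longrightarrow> card I \<le> l"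
  shows "(\<Sum>i<card V. i div l) \<le> card {{x, y} | x y. x \<in> V \<and> y \<in> V \<and> x \<noteq> y \<and> adj x y}"
  using assms(1) small
proof (induction V rule: finite_psubset_induct)
  case (psubset V)
  define indep where "indep I \<longleftrightarrow> I \<subseteq> V \<and> (\<forall>x\<in>I. \<forall>y\<in>I. x \<noteq> y \<longrightarrow> \<not> adj x y)" for I
  define E where "E U = {{x, y} | x y. x \<in> U \<and> y \<in> U \<and> x \<noteq> y \<and> adj x y}" for U
  show ?case
  proof (cases "V = {}")
    case True
    then show ?thesis by simp
  next
    case False
    then obtain v where "v \<in> V" by blast
    then have v: "indep {v}" by (auto simp: indep_def)
    have bdd: "card I \<le> card V" if "indep I" for I
      using that psubset.hyps by (auto simp: indep_def intro: card_mono)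
    obtain I where I: "indep I" and max: "\<And>J. indep J \<Longrightarrow> card J \<le> card I"
      using ex_has_greatest_nat[of indep "{v}" card "Suc (card V)"] v bdd by (metis le_imp_less_Suc)
    have IV: "I \<subseteq> V" and fin: "finite I"
      using I psubset.hyps by (auto simp: indep_def intro: finite_subset)
    have card_I: "card I \<le> l"
      using psubset.prems[of I] I by (auto simp: indep_def)
    have "I \<noteq> {}" using max[OF v] by auto
    have "\<exists>y\<in>I. adj x y" if "x \<in> V - I" for x
    proof (rule ccontr)
      assume "\<not> (\<exists>y\<in>I. adj x y)"
      then have "indep (insert x I)"
        using I that sym by (auto simp: indep_def)
      from max[OF this] show False using that fin by simp
    qed
    then obtain f where f: "\<And>x. x \<in> V - I \<Longrightarrow> f x \<in> I \<and> adj x (f x)"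
      by metis
    have finE: "finite (E U)" if "U \<subseteq> V" for U
      by (rule finite_subset[of _ "Pow V"]) (use that psubset.hyps in \<open>auto simp: E_def\<close>)
    \<comment> \<open>The edge \<open>{x, f x}\<close> has exactly one endpoint in \<open>I\<close>,
      so these edges are distinct for distinct \<open>x\<close> and differ from the edges inside
      \<open>V - I\<close>.\<close>
    have cross: "inj_on (\<lambda>x. {x, f x}) (V - I)"
      using f by (auto simp: inj_on_def doubleton_eq_iff)
    have "card V = card I + card (V - I)"
      using card_mono[OF psubset.hyps IV] by (simp add: card_Diff_subset[OF fin IV])
    then have "(\<Sum>i<card V. i div l) \<le> (\<Sum>i<card (V - I). i div l) + card (V - I)"
      using sum_div_diff_le[OF card_I, of "card V"] by simp
    also have "(\<Sum>i<card (V - I). i div l) \<le> card (E (V - I))"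
      unfolding E_def
    proof (rule psubset.IH)
      show "V - I \<subset> V" using IV \<open>I \<noteq> {}\<close> by blast
      show "card J \<le> l" if "J \<subseteq> V - I" "\<And>x y. x \<in> J \<Longrightarrow> y \<in> J \<Longrightarrow> x \<noteq> y \<Longrightarrow> \<not> adj x y" for J
        using psubset.prems[of J] that by blast
    qed
    also have "card (V - I) = card ((\<lambda>x. {x, f x}) ` (V - I))"
      using cross by (simp add: card_image)
    also have "card (E (V - I)) + card ((\<lambda>x. {x, f x}) ` (V - I)) =
        card (E (V - I) \<union> (\<lambda>x. {x, f x}) ` (V - I))"
      using f psubset.hyps finE[of "V - I"]
      by (intro card_Un_disjoint[symmetric]) (auto simp: E_def doubleton_eq_iff)
    also have "\<dots> \<le> card (E V)"
    proof (intro card_mono finE Un_least image_subsetI)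
      show "E (V - I) \<subseteq> E V" by (auto simp: E_def)
      fix x assume x: "x \<in> V - I"
      then have "x \<noteq> f x" "f x \<in> V" using f[OF x] IV by auto
      then show "{x, f x} \<in> E V" using f[OF x] x by (auto simp: E_def)
    qed simp
    finally show ?thesis by (simp add: E_def)
  qed
qed

text \<open>For fixed \<open>j\<close>, the smaller members of its residue class are told apart by
  their quotients, which lie below \<open>j div l\<close>.\<close>

lemma card_congruent_pairs_le:
  fixes l :: nat
  assumes "l > 0"
  shows "card {{i, j} | i j. i < j \<and> j < n \<and> i mod l = j mod l} \<le> (\<Sum>j<n. j div l)"
proof -
  have "card {i. i < j \<and> i mod l = j mod l} \<le> card {..<j div l}" for j
  proof (rule card_inj_on_le[where f = "\<lambda>i. i div l"])
    show "inj_on (\<lambda>i. i div l) {i. i < j \<and> i mod l = j mod l}"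
      by (rule inj_onI) (metis (mono_tags, lifting) div_mod_decomp mem_Collect_eq)
    have "i div l < j div l" if "i < j" "i mod l = j mod l" for i
      using that by (metis div_le_mono div_mod_decomp le_neq_implies_less less_imp_le_nat less_not_refl)
    then show "(\<lambda>i. i div l) ` {i. i < j \<and> i mod l = j mod l} \<subseteq> {..<j div l}" by auto
  qed auto
  then have le: "card ((\<lambda>i. {i, j}) ` {i. i < j \<and> i mod l = j mod l}) \<le> j div l" for j
    by (intro order_trans[OF card_image_le]) auto
  have "{{i, j} | i j. i < j \<and> j < n \<and> i mod l = j mod l} =
      (\<Union>j<n. (\<lambda>i. {i, j}) ` {i. i < j \<and> i mod l = j mod l})" by auto
  then show ?thesis
    using order_trans[OF card_UN_le sum_mono[OF le], of "{..<n}" "\<lambda>j. j"] by simp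
qed

section \<open>Book embeddings as cyclic words\<close>

text \<open>The list \<open>vs\<close> gives the order of the vertices along the spine, \<open>col\<close> is the bipartition,
  and \<open>pg a b\<close> is the page of the edge \<open>ab\<close>.\<close>

definition book_embedding :: "nat \<Rightarrow> ('a \<Rightarrow> bool) \<Rightarrow> ('a \<Rightarrow> 'a \<Rightarrow> nat) \<Rightarrow> 'a list \<Rightarrow> bool" where
  "book_embedding k col pg vs \<longleftrightarrow>
     (\<forall>a b. pg a b = pg b a) \<and>
     (\<forall>a\<in>set vs. \<forall>b\<in>set vs. col a \<noteq> col b \<longrightarrow> pg a b < k) \<and>
     (\<forall>a b c d. subseq [a, b, c, d] vs \<longrightarrow> col a \<noteq> col c \<longrightarrow> col b \<noteq> col d \<longrightarrow> pg a c \<noteq> pg b d)"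

lemma set_mono_subseq: "subseq us vs \<Longrightarrow> set us \<subseteq> set vs"
  by (metis notin_set_nthsI subseq_conv_nths subsetI)

lemma book_embedding_subseq:
  "book_embedding k col pg vs \<Longrightarrow> subseq us vs \<Longrightarrow> book_embedding k col pg us"
  unfolding book_embedding_def by (meson set_mono_subseq subseq_order.order_trans subsetD)

lemma subseq_rev: "subseq us vs \<Longrightarrow> subseq (rev us) (rev vs)"
  by (induction rule: list_emb.induct)
    (auto intro: subseq_rev_drop_many list_emb_append_mono)

text \<open>Read backwards, a quadruple still pairs its first with its third and its second with its
  fourth vertex.\<close>

lemma book_embedding_rev:
  assumes "book_embedding k col pg vs"
  shows "book_embedding k col pg (rev vs)"
proof -
  have "subseq [d, c, b, a] vs" if "subseq [a, b, c, d] (rev vs)" for a b c d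
    using subseq_rev[OF that] by simp
  with assms show ?thesis
    unfolding book_embedding_def set_rev by metis
qed

lemma book_embedding_rotate1:
  assumes "book_embedding k col pg (x # xs)"
  shows "book_embedding k col pg (xs @ [x])"
proof -
  \<comment> \<open>A quadruple ending in the moved vertex \<open>x\<close> becomes
    \<open>x, a, b, c\<close>, which alternates in the same two unordered pairs.\<close>
  have "subseq [a, b, c, d] xs \<or> d = x \<and> subseq [x, a, b, c] (x # xs)"
    if "subseq [a, b, c, d] (xs @ [x])" for a b c d
  proof -
    from that obtain us ws where *: "[a, b, c, d] = us @ ws" "subseq us xs" "subseq ws [x]"
      unfolding subseq_append_iff by blast
    from *(3) have "ws = [] \<or> ws = [x]"
      by (cases ws) (auto elim!: list_emb.cases[of _ _ "[]"] split: if_splits)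
    with * show ?thesis by (auto simp: append_eq_Cons_conv Cons_eq_append_conv)
  qed
  with assms show ?thesis
    unfolding book_embedding_def set_append list.set
    by (smt (verit, ccfv_threshold) Un_commute list_emb_Cons insert_is_Un)
qed

lemma book_embedding_append_commute:
  "book_embedding k col pg (us @ vs) \<Longrightarrow> book_embedding k col pg (vs @ us)"
proof (induction us arbitrary: vs)
  case (Cons u us)
  then have "book_embedding k col pg (us @ (vs @ [u]))"
    using book_embedding_rotate1[of k col pg u "us @ vs"] by simp
  from Cons.IH[OF this] show ?case by simp
qed simp

text \<open>A gap list counts the consecutive \<open>False\<close> vertices after each of the \<open>True\<close> vertices.\<close>

definition gap_word :: "nat list \<Rightarrow> bool list" where
  "gap_word gs = concat (map (\<lambda>g. True # replicate g False) gs)"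

lemma gap_word_simps [simp]:
  "gap_word [] = []"
  "gap_word (g # gs) = True # replicate g False @ gap_word gs"
  "gap_word (gs @ hs) = gap_word gs @ gap_word hs"
  by (simp_all add: gap_word_def)

section \<open>Symmetry and monotonicity of forbidden gap lists\<close>

definition forbidden :: "nat \<Rightarrow> nat list \<Rightarrow> bool" where
  "forbidden k gs \<longleftrightarrow> (\<forall>(vs :: (nat + nat) list) col pg.
     map col vs = gap_word gs \<longrightarrow> \<not> book_embedding k col pg vs)"

lemma forbidden_rotate1:
  assumes "forbidden k gs"
  shows "forbidden k (rotate1 gs)"
proof (cases gs)
  case (Cons g hs)
  show ?thesis
    unfolding forbidden_def
  proof (intro allI impI notI)
    fix vs :: "(nat + nat) list" and col pg
    assume "map col vs = gap_word (rotate1 gs)" and emb: "book_embedding k col pg vs"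
    then obtain us ws where "vs = us @ ws" "map col us = gap_word hs" "map col ws = gap_word [g]"
      by (auto simp: Cons map_eq_append_conv simp del: gap_word_simps(2))
    then have "map col (ws @ us) = gap_word gs" "book_embedding k col pg (ws @ us)"
      using emb by (auto simp: Cons intro: book_embedding_append_commute)
    then show False using assms unfolding forbidden_def by blast
  qed
qed (use assms in simp)

lemma forbidden_rotate: "forbidden k gs \<Longrightarrow> forbidden k (rotate n gs)"
  by (induction n) (auto intro: forbidden_rotate1)

text \<open>Reversal puts the red vertex of each block at its end; one more \<open>True\<close> in
  front makes the blocks start with a red vertex again.\<close>

lemma Cons_rev_gap_word: "True # rev (gap_word gs) = gap_word (rev gs) @ [True]"
proof (induction gs)
  case (Cons g gs)
  have "True # rev (gap_word (g # gs)) = (True # rev (gap_word gs)) @ replicate g False @ [True]"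
    by simp
  then show ?case unfolding Cons.IH by simp
qed simp

text \<open>The embedding is rotated by one vertex before it is reversed, so that the reversed word
  starts with a red vertex.\<close>

lemma forbidden_rev:
  assumes "forbidden k gs"
  shows "forbidden k (rev gs)"
proof (cases "gs = []")
  case False
  show ?thesis
    unfolding forbidden_def
  proof (intro allI impI notI)
    fix vs :: "(nat + nat) list" and col pg
    assume vs: "map col vs = gap_word (rev gs)" and emb: "book_embedding k col pg vs"
    then have *: "map col vs @ [True] = True # rev (gap_word gs)"
      by (simp add: Cons_rev_gap_word)
    obtain x us where x: "vs = x # us"
      using * False by (cases vs; cases gs) auto
    with * have "map col (us @ [x]) = rev (gap_word gs)" by auto
    then have "map col (rev (us @ [x])) = gap_word gs" by (metis rev_map rev_rev_ident)
    moreover have "book_embedding k col pg (rev (us @ [x]))"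
      using emb unfolding x by (intro book_embedding_rev book_embedding_rotate1)
    ultimately show False using assms unfolding forbidden_def by blast
  qed
qed (use assms in simp)

lemma subseq_gap_word: "list_all2 (\<le>) cs gs \<Longrightarrow> subseq (gap_word cs) (gap_word gs)"
proof (induction rule: list_all2_induct)
  case (Cons c cs g gs)
  then obtain d where "g = d + c" using le_Suc_ex by (metis add.commute)
  then have "subseq (replicate c False) (replicate g False)"
    by (simp add: replicate_add subseq_drop_many)
  with Cons show ?case by (simp add: list_emb_append_mono)
qed simp

lemma subseq_map_obtain:
  assumes "subseq ws (map f vs)"
  obtains us where "subseq us vs" "map f us = ws"
  using assms by (metis nths_map subseq_conv_nths)

text \<open>Deleting blue vertices from an embedding leaves an embedding.\<close>

lemma forbidden_mono:
  assumes "forbidden k cs" "list_all2 (\<le>) cs gs"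
  shows "forbidden k gs"
  unfolding forbidden_def
proof (intro allI impI notI)
  fix vs :: "(nat + nat) list" and col pg
  assume "map col vs = gap_word gs" and emb: "book_embedding k col pg vs"
  then obtain us where "subseq us vs" "map col us = gap_word cs"
    using subseq_gap_word[OF assms(2)] by (metis subseq_map_obtain)
  then show False
    using assms(1) emb book_embedding_subseq unfolding forbidden_def by blast
qed

lemma word_gap_decomposition:
  "\<exists>g gs. w = replicate g False @ gap_word gs \<and> length gs = length (filter (\<lambda>x. x) w) \<and>
     g + sum_list gs = length (filter Not w)"
proof (induction w)
  case (Cons x w)
  then obtain g gs where *: "w = replicate g False @ gap_word gs"
    "length gs = length (filter (\<lambda>x. x) w)" "g + sum_list gs = length (filter Not w)"
    by blast
  show ?case
  proof (cases x)
    case True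
    with * show ?thesis by (intro exI[of _ 0] exI[of _ "g # gs"]) auto
  next
    case False
    with * show ?thesis by (intro exI[of _ "Suc g"] exI[of _ gs]) auto
  qed
qed simp

text \<open>Up to rotation, every colour word with a red vertex is the word of a gap list.\<close>

lemma not_book_embedding_if_forbidden:
  fixes vs :: "(nat + nat) list"
  assumes forb: "\<And>gs. length gs = m \<Longrightarrow> sum_list gs = s \<Longrightarrow> forbidden k gs"
    and "m > 0" "length (filter col vs) = m" "length (filter (\<lambda>v. \<not> col v) vs) = s"
  shows "\<not> book_embedding k col pg vs"
proof
  assume emb: "book_embedding k col pg vs"
  obtain g gs where *: "map col vs = replicate g False @ gap_word gs"
    "length gs = length (filter (\<lambda>x. x) (map col vs))" "g + sum_list gs = length (filter Not (map col vs))"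
    using word_gap_decomposition by blast
  have len: "length gs = m" "g + sum_list gs = s"
    using *(2,3) assms(3,4) by (simp_all only: filter_map o_def length_map)
  with \<open>m > 0\<close> obtain hs h where gs: "gs = hs @ [h]" by (cases gs rule: rev_cases) auto
  \<comment> \<open>The rotation moves the \<open>g\<close> leading blue vertices into the last
    gap.\<close>
  let ?hs = "hs @ [h + g]"
  obtain us ws where uw: "vs = us @ ws" "map col us = replicate g False" "map col ws = gap_word gs"
    using *(1) by (auto simp: map_eq_append_conv)
  have "map col (ws @ us) = gap_word ?hs"
    using uw by (simp add: gs replicate_add)
  moreover have "book_embedding k col pg (ws @ us)"
    using emb uw(1) by (simp add: book_embedding_append_commute)
  moreover have "length ?hs = m" "sum_list ?hs = s" using len by (simp_all add: gs)
  ultimately show False using forb unfolding forbidden_def by blast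
qed

section \<open>Certificates\<close>

text \<open>\<open>f i j\<close> bounds the weight of a noncrossing set of chords of the interval from \<open>i\<close> to \<open>j\<close>:
  such a set splits at the farthest \<open>l < j\<close> joined to \<open>i\<close>.\<close>

lemma noncrossing_weight_le:
  fixes w f :: "nat \<Rightarrow> nat \<Rightarrow> nat"
  assumes split: "\<And>i l j. i < l \<Longrightarrow> l < j \<Longrightarrow> j < N \<Longrightarrow> w i j + f i l + f l j \<le> f i j"
    and base: "\<And>i. Suc i < N \<Longrightarrow> w i (Suc i) \<le> f i (Suc i)"
    and "i < j" "j < N"
    and "\<And>a b. (a, b) \<in> S \<Longrightarrow> i \<le> a \<and> a < b \<and> b \<le> j"
    and "\<And>a b c d. (a, b) \<in> S \<Longrightarrow> (c, d) \<in> S \<Longrightarrow> \<not> (a < c \<and> c < b \<and> b < d)"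
  shows "(\<Sum>(a, b)\<in>S. w a b) \<le> f i j"
  using assms(3-)
proof (induction "j - i" arbitrary: i j S rule: less_induct)
  case less
  note ij = less.prems(1,2) and S = less.prems(3) and nc = less.prems(4)
  have fin: "finite S"
    by (rule finite_subset[of _ "{..j} \<times> {..j}"]) (use S in fastforce)+
  have drop: "(\<Sum>(a, b)\<in>S. w a b) \<le> w i j + (\<Sum>(a, b)\<in>S - {(i, j)}. w a b)"
    using fin by (cases "(i, j) \<in> S") (simp_all add: sum.remove)
  show ?case
  proof (cases "j = Suc i")
    case True
    then have "S - {(i, j)} = {}" using S by fastforce
    then have "(\<Sum>(a, b)\<in>S - {(i, j)}. w a b) = 0" by (simp only: sum.empty)
    with drop base[of i] ij True show ?thesis by simp
  next
    case False
    \<comment> \<open>The default \<open>Suc i\<close> serves when \<open>i\<close> has no chord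
      except possibly \<open>(i, j)\<close>: all other chords then start at \<open>Suc i\<close> or
      later.\<close>
    define l where "l = (if \<exists>l<j. (i, l) \<in> S then Max {l. l < j \<and> (i, l) \<in> S} else Suc i)"
    have l: "i < l \<and> l < j \<and> (\<forall>(a, b)\<in>S - {(i, j)}. b \<le> l \<or> l \<le> a)"
    proof (cases "\<exists>l<j. (i, l) \<in> S")
      case True
      let ?L = "{l. l < j \<and> (i, l) \<in> S}"
      have "finite ?L" "?L \<noteq> {}" using True by auto
      then have "l \<in> ?L" and max: "\<And>b. b \<in> ?L \<Longrightarrow> b \<le> l"
        using Max_in[of ?L] Max_ge[of ?L] True by (simp_all add: l_def)
      then have il: "(i, l) \<in> S" "l < j" by auto
      \<comment> \<open>A chord at \<open>i\<close> ends by \<open>l\<close> because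
        \<open>l\<close> is maximal; one that starts strictly between \<open>i\<close> and
        \<open>l\<close> and ends beyond \<open>l\<close> would cross \<open>(i, l)\<close>.\<close>
      have "b \<le> l \<or> l \<le> a" if "(a, b) \<in> S - {(i, j)}" for a b
      proof (cases "a = i")
        case True
        then have "b < j" using that S[of a b] by auto
        then show ?thesis using max[of b] that True by auto
      next
        case False
        then show ?thesis using nc[OF il(1), of a b] that S[of a b] by force
      qed
      then show ?thesis using il S[of i l] by auto
    next
      case none: False
      have "Suc i \<le> a" if "(a, b) \<in> S - {(i, j)}" for a b
        using that none S[of a b] by (cases "a = i") (auto simp: le_less)
      then show ?thesis using ij False none by (auto simp: l_def)
    qed
    let ?A = "{(a, b) \<in> S - {(i, j)}. b \<le> l}" and ?B = "{(a, b) \<in> S - {(i, j)}. l \<le> a}"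
    have "S - {(i, j)} = ?A \<union> ?B" using l by auto
    then have "(\<Sum>(a, b)\<in>S - {(i, j)}. w a b) \<le> (\<Sum>(a, b)\<in>?A. w a b) + (\<Sum>(a, b)\<in>?B. w a b)"
      using sum_Un_nat[of ?A ?B "\<lambda>(a, b). w a b"] fin
      by (metis (no_types, lifting) diff_le_self finite_Diff finite_Un)
    also have "(\<Sum>(a, b)\<in>?A. w a b) \<le> f i l"
      by (rule less.hyps) (use l ij S nc in \<open>auto\<close>)
    also have "(\<Sum>(a, b)\<in>?B. w a b) \<le> f l j"
      by (rule less.hyps) (use l ij S nc in \<open>auto\<close>)
    finally show ?thesis using drop split[of i l j] l ij by simp
  qed
qed

text \<open>Row \<open>i\<close> of the table lists the bounds \<open>f i (i + 1), f i (i + 2), \<dots>\<close>. It is computed from the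
  weights \<open>w i (i + 1), \<dots>\<close> and the later rows; the last argument accumulates the maximum of
  \<open>f i l + f l j\<close> over the \<open>l\<close> treated so far.\<close>

fun bound_row :: "nat list \<Rightarrow> nat list list \<Rightarrow> nat list \<Rightarrow> nat list" where
  "bound_row (w # ws) (r # rs) (p # ps) =
     (let v = w + p in v # bound_row ws rs (map2 (\<lambda>a b. max a (v + b)) ps r))"
| "bound_row _ _ _ = []"

fun bound_table :: "(nat \<times> nat) list \<Rightarrow> nat \<Rightarrow> nat \<Rightarrow> nat list list" where
  "bound_table F i 0 = []"
| "bound_table F i (Suc n) =
     (let T = bound_table F (Suc i) n
      in bound_row (map (\<lambda>j. count_list F (i, j)) [Suc i..<Suc i + n]) T (replicate n 0) # T)"

section \<open>Correctness of the dynamic program\<close>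

text \<open>These are the \<open>base\<close> and \<open>split\<close> inequalities of
  \<open>noncrossing_weight_le\<close> within row \<open>i\<close>, where position \<open>b\<close>
  stands for the vertex \<open>i + 1 + b\<close>. They hold since the accumulator only grows along
  the recursion.\<close>

lemma bound_row_spec:
  assumes "length rs = length ws" "length ps = length ws"
    and "\<And>l. l < length ws \<Longrightarrow> length (rs ! l) = length ws - 1 - l"
  shows "length (bound_row ws rs ps) = length ws"
    and "\<And>b. b < length ws \<Longrightarrow> ws ! b + ps ! b \<le> bound_row ws rs ps ! b"
    and "\<And>l b. l < b \<Longrightarrow> b < length ws \<Longrightarrow>
      ws ! b + bound_row ws rs ps ! l + rs ! l ! (b - l - 1) \<le> bound_row ws rs ps ! b"
proof -
  have "length (bound_row ws rs ps) = length ws \<and>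
    (\<forall>b<length ws. ws ! b + ps ! b \<le> bound_row ws rs ps ! b) \<and>
    (\<forall>b<length ws. \<forall>l<b.
      ws ! b + bound_row ws rs ps ! l + rs ! l ! (b - l - 1) \<le> bound_row ws rs ps ! b)"
    using assms
  proof (induction ws rs ps rule: bound_row.induct)
    case (1 w ws r rs p ps)
    let ?qs = "map2 (\<lambda>a b. max a (w + p + b)) ps r"
    have len: "length r = length ws" "length ?qs = length ws"
      using "1.prems"(3)[of 0] "1.prems"(2) by simp_all
    have IH: "length (bound_row ws rs ?qs) = length ws \<and>
      (\<forall>b<length ws. ws ! b + ?qs ! b \<le> bound_row ws rs ?qs ! b) \<and>
      (\<forall>b<length ws. \<forall>l<b.
        ws ! b + bound_row ws rs ?qs ! l + rs ! l ! (b - l - 1) \<le> bound_row ws rs ?qs ! b)"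
    proof (rule "1.IH")
      show "length rs = length ws" using "1.prems"(1) by simp
      show "length (rs ! l) = length ws - 1 - l" if "l < length ws" for l
        using "1.prems"(3)[of "Suc l"] that by simp
    qed (use len in simp_all)
    have qs: "?qs ! b = max (ps ! b) (w + p + r ! b)" if "b < length ws" for b
      using that len "1.prems"(2) by simp
    show ?case
      unfolding bound_row.simps Let_def
    proof (intro conjI allI impI, goal_cases)
      case (2 b)
      then show ?case
      proof (cases b)
        case (Suc c)
        then show ?thesis using 2 IH qs[of c] by fastforce
      qed simp
    next
      case (3 b l)
      then obtain c where b: "b = Suc c" and c: "c < length ws" by (cases b) auto
      show ?case
      proof (cases l)
        case 0
        then show ?thesis using b c IH qs[of c] by fastforce
      next
        case (Suc l')
        then show ?thesis using b c 3 IH by simp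
      qed
    qed (use IH in simp)
  qed simp_all
  then show "length (bound_row ws rs ps) = length ws"
    and "\<And>b. b < length ws \<Longrightarrow> ws ! b + ps ! b \<le> bound_row ws rs ps ! b"
    and "\<And>l b. l < b \<Longrightarrow> b < length ws \<Longrightarrow>
      ws ! b + bound_row ws rs ps ! l + rs ! l ! (b - l - 1) \<le> bound_row ws rs ps ! b"
    by blast+
qed

lemma bound_table_length:
  "length (bound_table F i n) = n"
  "a < n \<Longrightarrow> length (bound_table F i n ! a) = n - 1 - a"
proof -
  have "length (bound_table F i n) = n \<and> (\<forall>a<n. length (bound_table F i n ! a) = n - 1 - a)"
  proof (induction n arbitrary: i)
    case (Suc n)
    let ?ws = "map (\<lambda>j. count_list F (i, j)) [Suc i..<Suc i + n]"
    have "length (bound_row ?ws (bound_table F (Suc i) n) (replicate n 0)) = n"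
      using bound_row_spec(1)[of "bound_table F (Suc i) n" ?ws "replicate n 0"] Suc.IH
      by (simp del: upt_Suc)
    then show ?case
      using Suc.IH by (auto simp: Let_def nth_Cons simp del: upt_Suc split: nat.splits)
  qed simp
  then show "length (bound_table F i n) = n"
    "a < n \<Longrightarrow> length (bound_table F i n ! a) = n - 1 - a" by auto
qed

lemma bound_table_nth: "a < n \<Longrightarrow> bound_table F i n ! a = hd (bound_table F (i + a) (n - a))"
proof (induction n arbitrary: i a)
  case (Suc n)
  then show ?case by (cases a) (simp_all add: Let_def)
qed simp

lemma noncrossing_count_le:
  assumes "1 < N" and "\<And>a b. (a, b) \<in> S \<Longrightarrow> a < b \<and> b < N"
    and "\<And>a b c d. (a, b) \<in> S \<Longrightarrow> (c, d) \<in> S \<Longrightarrow> \<not> (a < c \<and> c < b \<and> b < d)"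
  shows "(\<Sum>e\<in>S. count_list F e) \<le> last (hd (bound_table F 0 N))"
proof -
  \<comment> \<open>Position 0 of row \<open>a\<close> belongs to the chord from \<open>a\<close> to
    \<open>a + 1\<close>, hence the shift by one.\<close>
  define f where "f a b = hd (bound_table F a (N - a)) ! (b - a - 1)" for a b
  have ineqs: "(\<forall>j. i < j \<and> j < N \<longrightarrow> count_list F (i, j) \<le> f i j) \<and>
      (\<forall>l j. i < l \<and> l < j \<and> j < N \<longrightarrow> count_list F (i, j) + f i l + f l j \<le> f i j)"
    if "Suc i < N" for i
  proof -
    define n where "n = N - Suc i"
    then have n: "N - i = Suc n" using that by simp
    define ws where "ws = map (\<lambda>j. count_list F (i, j)) [Suc i..<Suc i + n]"
    define T where "T = bound_table F (Suc i) n"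
    have f_i: "f i j = bound_row ws T (replicate n 0) ! (j - i - 1)" for j
      by (simp add: f_def n ws_def T_def Let_def del: upt_Suc)
    have ws: "length ws = n" "\<And>b. b < n \<Longrightarrow> ws ! b = count_list F (i, Suc i + b)"
      by (simp_all add: ws_def del: upt_Suc)
    have len: "length T = length ws" "length (replicate n 0) = length ws"
      "\<And>l. l < length ws \<Longrightarrow> length (T ! l) = length ws - 1 - l"
      by (simp_all add: T_def ws bound_table_length)
    have spec: "\<And>b. b < n \<Longrightarrow> ws ! b + replicate n 0 ! b \<le> bound_row ws T (replicate n 0) ! b"
      "\<And>l b. l < b \<Longrightarrow> b < n \<Longrightarrow> ws ! b + bound_row ws T (replicate n 0) ! l + T ! l ! (b - l - 1)
        \<le> bound_row ws T (replicate n 0) ! b"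
      using bound_row_spec(2,3)[of T ws "replicate n 0"] len ws(1) by blast+
    show ?thesis
    proof (intro conjI allI impI)
      fix j assume "i < j \<and> j < N"
      then have "j - i - 1 < n" "Suc i + (j - i - 1) = j" using n by auto
      then show "count_list F (i, j) \<le> f i j"
        using spec(1)[of "j - i - 1"] by (simp add: f_i ws del: One_nat_def)
    next
      fix l j assume lj: "i < l \<and> l < j \<and> j < N"
      then have b: "j - i - 1 < n" "Suc i + (j - i - 1) = j" and l: "l - i - 1 < j - i - 1"
        using n by auto
      have "n - (l - i - 1) = N - l" "Suc i + (l - i - 1) = l" using n lj by auto
      then have "T ! (l - i - 1) = hd (bound_table F l (N - l))"
        using bound_table_nth[of "l - i - 1" n F "Suc i"] b(1) l by (simp add: T_def)
      moreover have "j - i - 1 - (l - i - 1) - 1 = j - l - 1" using lj by auto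
      ultimately have "T ! (l - i - 1) ! (j - i - 1 - (l - i - 1) - 1) = f l j"
        by (simp only: f_def)
      then show "count_list F (i, j) + f i l + f l j \<le> f i j"
        using spec(2)[OF l] b by (simp add: f_i ws del: One_nat_def)
    qed
  qed
  have "(\<Sum>(a, b)\<in>S. count_list F (a, b)) \<le> f 0 (N - 1)"
  proof (rule noncrossing_weight_le[where N = N and f = f and w = "\<lambda>a b. count_list F (a, b)"])
    show "count_list F (i, j) + f i l + f l j \<le> f i j" if "i < l" "l < j" "j < N" for i l j
      using ineqs[of i] that by simp
    show "count_list F (i, Suc i) \<le> f i (Suc i)" if "Suc i < N" for i
      using ineqs[of i] that by simp
    show "0 \<le> a \<and> a < b \<and> b \<le> N - 1" if "(a, b) \<in> S" for a b
      using assms(2)[OF that] by auto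
  qed (use assms in auto)
  moreover have "f 0 (N - 1) = last (hd (bound_table F 0 N))"
  proof -
    have "hd (bound_table F 0 N) = bound_table F 0 N ! 0"
      using assms(1) bound_table_length(1)[of F 0 N] by (intro hd_conv_nth) auto
    then have "length (hd (bound_table F 0 N)) = N - 1"
      using bound_table_length(2)[of 0 N F 0] assms(1) by simp
    then show ?thesis
      using assms(1) by (subst last_conv_nth) (auto simp: f_def)
  qed
  ultimately show ?thesis by simp
qed

text \<open>The dual certificate: \<open>F\<close> may contain repeated edges, which count with multiplicity.\<close>

definition certificate :: "nat \<Rightarrow> nat list \<times> (nat \<times> nat) list \<Rightarrow> bool" where
  "certificate k = (\<lambda>(gs, F). let w = gap_word gs; N = length w in
     1 < N \<and> list_all (\<lambda>(i, j). i < j \<and> j < N \<and> w ! i \<noteq> w ! j) F \<and>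
     k * last (hd (bound_table F 0 N)) < length F)"

text \<open>In an embedding the pages would split \<open>F\<close> into \<open>k\<close> noncrossing
  classes of weight at most \<open>W\<close> each, so \<open>F\<close> would have at most
  \<open>k * W\<close> elements with multiplicity.\<close>

lemma forbidden_if_certificate:
  assumes "certificate k (gs, F)"
  shows "forbidden k gs"
  unfolding forbidden_def
proof (intro allI impI notI)
  fix vs :: "(nat + nat) list" and col pg
  assume col: "map col vs = gap_word gs" and emb: "book_embedding k col pg vs"
  define N where "N = length vs"
  define W where "W = last (hd (bound_table F 0 N))"
  define page where "page e = pg (vs ! fst e) (vs ! snd e)" for e
  have N: "N = length (gap_word gs)" using arg_cong[OF col, of length] by (simp add: N_def)
  have "col (vs ! i) = gap_word gs ! i" if "i < N" for i
    using that nth_map[of i vs col] by (simp add: col N_def)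
  then have F: "i < j \<and> j < N \<and> col (vs ! i) \<noteq> col (vs ! j)" if "(i, j) \<in> set F" for i j
    using assms that by (fastforce simp: certificate_def Let_def list_all_iff N)
  have "1 < N" and big: "k * W < length F"
    using assms by (simp_all add: certificate_def Let_def W_def N)
  have sub: "subseq [vs ! a, vs ! b, vs ! c, vs ! d] vs" if "a < b" "b < c" "c < d" "d < N" for a b c d
  proof -
    have "subseq (map ((!) vs) [a, b, c, d]) (map ((!) vs) [0..<N])"
      by (intro subseq_map sorted_subset_imp_subseq) (use that in \<open>auto\<close>)
    then show ?thesis by (simp add: N_def map_nth)
  qed
  have "(\<Sum>e\<in>{e \<in> set F. page e = p}. count_list F e) \<le> W" for p
    unfolding W_def
  proof (rule noncrossing_count_le[OF \<open>1 < N\<close>])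
    fix a b c d
    assume *: "(a, b) \<in> {e \<in> set F. page e = p}" "(c, d) \<in> {e \<in> set F. page e = p}"
    show "\<not> (a < c \<and> c < b \<and> b < d)"
    proof
      assume "a < c \<and> c < b \<and> b < d"
      then have "subseq [vs ! a, vs ! c, vs ! b, vs ! d] vs" using sub F[of c d] * by auto
      then have "pg (vs ! a) (vs ! b) \<noteq> pg (vs ! c) (vs ! d)"
        using emb F[of a b] F[of c d] * by (auto simp: book_embedding_def)
      then show False using * by (simp add: page_def)
    qed
  qed (use F in auto)
  then have "(\<Sum>p<k. \<Sum>e\<in>{e \<in> set F. page e = p}. count_list F e) \<le> (\<Sum>p<k. W)"
    by (rule sum_mono)
  \<comment> \<open>Each edge of \<open>F\<close> lies on exactly one page below \<open>k\<close>;
    the multiplicities over \<open>set F\<close> add up to \<open>length F\<close>.\<close>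
  moreover have "(\<Sum>p<k. \<Sum>e\<in>{e \<in> set F. page e = p}. count_list F e) = (\<Sum>e\<in>set F. count_list F e)"
  proof (rule sum.group)
    have "page (i, j) < k" if "(i, j) \<in> set F" for i j
      using emb F[OF that] by (auto simp: book_embedding_def page_def N_def)
    then show "page ` set F \<subseteq> {..<k}" by auto
  qed auto
  ultimately have "length F \<le> k * W" by (simp add: sum_count_set)
  with big show False by simp
qed

section \<open>Unavoidable gap lists\<close>

text \<open>Evaluating \<open>covers\<close> filters long lists again and again. With the congruence rule for
  \<open>Frozen\<close>, the simplifier does not traverse a list again once it has been computed.\<close>

datatype frozen = Nil_frozen | Frozen "nat list" frozen

lemma Frozen_cong: "Frozen x xs = Frozen x xs" by (rule refl)

primrec frozen_set :: "frozen \<Rightarrow> nat list set" where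
  "frozen_set Nil_frozen = {}"
| "frozen_set (Frozen x xs) = insert x (frozen_set xs)"

definition freeze :: "nat list \<Rightarrow> frozen \<Rightarrow> frozen" where
  "freeze c cs = Frozen c cs"

text \<open>The first list may be shorter; its missing entries count as zeros.\<close>

primrec dominated :: "nat list \<Rightarrow> nat list \<Rightarrow> bool" where
  "dominated [] gs = True"
| "dominated (c # cs) gs = (case gs of [] \<Rightarrow> False | g # gs' \<Rightarrow> c \<le> g \<and> dominated cs gs')"

fun has_Nil :: "frozen \<Rightarrow> bool" where
  "has_Nil Nil_frozen = False"
| "has_Nil (Frozen [] cs) = True"
| "has_Nil (Frozen (x # xs) cs) = has_Nil cs"

text \<open>What remains of the cores once the head \<open>v\<close> of the gap list is fixed. An
  exhausted core is dominated by every list, so the others are then dropped.\<close>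

fun fits_after :: "nat \<Rightarrow> frozen \<Rightarrow> frozen \<Rightarrow> frozen" where
  "fits_after v Nil_frozen acc = acc"
| "fits_after v (Frozen [] cs) acc = Frozen [] Nil_frozen"
| "fits_after v (Frozen (x # xs) cs) acc =
     fits_after v cs (if x \<le> v then Frozen xs acc else acc)"

text \<open>\<open>covers s Ms cs\<close>: every list with sum \<open>s\<close> that is bounded entrywise by \<open>Ms\<close> dominates an
  element of \<open>cs\<close>. No bounded quantifiers here, since the simplifier would evaluate their bodies
  symbolically.\<close>

fun covers :: "nat \<Rightarrow> nat list \<Rightarrow> frozen \<Rightarrow> bool"
  and covers_heads :: "nat list \<Rightarrow> nat \<Rightarrow> nat list \<Rightarrow> frozen \<Rightarrow> bool" where
  "covers s [] cs = has_Nil cs"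
| "covers s (M # Ms) cs =
     (if has_Nil cs then True else covers_heads [s - sum_list Ms..<Suc (min s M)] s Ms cs)"
| "covers_heads [] s Ms cs = True"
| "covers_heads (v # vs) s Ms cs =
     (if covers (s - v) Ms (fits_after v cs Nil_frozen) then covers_heads vs s Ms cs else False)"

text \<open>The first argument only counts the rotations. Trailing zeros are dropped, so that a core is
  satisfied as soon as it is exhausted.\<close>

primrec add_rotations :: "nat list \<Rightarrow> nat list \<Rightarrow> frozen \<Rightarrow> frozen" where
  "add_rotations [] c cs = cs"
| "add_rotations (x # xs) c cs =
     add_rotations xs (rotate1 c) (freeze (rev (dropWhile (\<lambda>x. x = 0) (rev c))) cs)"

primrec dihedral_closure :: "nat list list \<Rightarrow> frozen" where
  "dihedral_closure [] = Nil_frozen"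
| "dihedral_closure (c # cs) = add_rotations c c (add_rotations c (rev c) (dihedral_closure cs))"

primrec covers_max_heads :: "nat list \<Rightarrow> nat \<Rightarrow> nat list \<Rightarrow> frozen \<Rightarrow> bool" where
  "covers_max_heads [] s us cs = True"
| "covers_max_heads (M # Ms) s us cs =
     (if covers (s - M) (map (\<lambda>_. M) us) (fits_after M cs Nil_frozen)
      then covers_max_heads Ms s us cs else False)"

text \<open>By symmetry, only gap lists whose head is maximal are inspected. Only the length of
  \<open>tl (hd cs)\<close> matters.\<close>

definition unavoidable :: "nat \<Rightarrow> nat list list \<Rightarrow> bool" where
  "unavoidable s cs = covers_max_heads [0..<Suc s] s (tl (hd cs)) (dihedral_closure cs)"

section \<open>Soundness of the covering search\<close>

lemma has_Nil_iff: "has_Nil cs \<longleftrightarrow> [] \<in> frozen_set cs"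
  by (induction cs rule: has_Nil.induct) auto

lemma frozen_set_fits_after:
  "c \<in> frozen_set (fits_after v cs acc) \<Longrightarrow>
    c \<in> frozen_set acc \<or> c = [] \<and> [] \<in> frozen_set cs \<or> (\<exists>x\<le>v. x # c \<in> frozen_set cs)"
  by (induction v cs acc rule: fits_after.induct) (auto split: if_splits)

lemma dominated_if_fits_after:
  assumes "c \<in> frozen_set (fits_after v cs Nil_frozen)" "dominated c gs"
  shows "\<exists>c\<in>frozen_set cs. dominated c (v # gs)"
  using frozen_set_fits_after[OF assms(1)] assms(2) by force

text \<open>Follows the mutual recursion: a remainder dominated by the tail comes from a core
  dominated by the whole list.\<close>

lemma covers_sound:
  "covers s Ms cs \<Longrightarrow> list_all2 (\<le>) gs Ms \<Longrightarrow> sum_list gs = s \<Longrightarrow>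
    \<exists>c\<in>frozen_set cs. dominated c gs"
  "covers_heads vs s Ms cs \<Longrightarrow> v \<in> set vs \<Longrightarrow> list_all2 (\<le>) gs Ms \<Longrightarrow> v + sum_list gs = s \<Longrightarrow>
    \<exists>c\<in>frozen_set cs. dominated c (v # gs)"
proof (induction s Ms cs and vs s Ms cs arbitrary: gs and v gs rule: covers_covers_heads.induct)
  case (1 s cs)
  then show ?case by (auto simp: has_Nil_iff intro!: bexI[of _ "[]"])
next
  case (2 s M Ms cs)
  obtain g hs where gs: "gs = g # hs" "g \<le> M" "list_all2 (\<le>) hs Ms"
    using 2(3) by (auto simp: list_all2_Cons2)
  show ?case
  proof (cases "has_Nil cs")
    case True
    then show ?thesis by (auto simp: has_Nil_iff intro!: bexI[of _ "[]"])
  next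
    case False
    \<comment> \<open>This justifies the lower end \<open>s - sum_list Ms\<close> of the range of
      heads.\<close>
    have "sum_list hs \<le> sum_list Ms"
      using gs(3) by (induction rule: list_all2_induct) auto
    then have "g \<in> set [s - sum_list Ms..<Suc (min s M)]"
      using 2(4) gs(1,2) by auto
    then show ?thesis
      using 2(1)[OF False _ _ gs(3)] 2(2,4) False gs(1) by simp
  qed
next
  case (3 s Ms cs)
  then show ?case by simp
next
  case (4 v' vs s Ms cs)
  from 4(3) have c: "covers (s - v') Ms (fits_after v' cs Nil_frozen)" "covers_heads vs s Ms cs"
    by (simp_all split: if_splits)
  show ?case
  proof (cases "v = v'")
    case True
    then have "\<exists>c\<in>frozen_set (fits_after v' cs Nil_frozen). dominated c gs"
      using 4(1)[OF c(1) 4(5)] 4(6) by auto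
    then show ?thesis using dominated_if_fits_after True by blast
  next
    case False
    then show ?thesis using 4(2)[OF c(1) c(2) _ 4(5)] 4(4,6) by simp
  qed
qed

lemma list_all2_if_dominated_strip:
  assumes "dominated (rev (dropWhile (\<lambda>x. x = 0) (rev c))) gs" "length c = length gs"
  shows "list_all2 (\<le>) c gs"
  using assms
proof (induction c arbitrary: gs)
  case (Cons x c)
  then obtain g hs where gs: "gs = g # hs" by (cases gs) auto
  have zeros: "list_all2 (\<le>) c hs" if "\<forall>y\<in>set c. y = 0"
  proof -
    have "c ! i = 0" if "i < length c" for i
      using \<open>\<forall>y\<in>set c. y = 0\<close> nth_mem[OF that] by blast
    then show ?thesis using Cons.prems(2) by (simp add: gs list_all2_conv_all_nth)
  qed
  \<comment> \<open>The entry \<open>x\<close> can be stripped as a trailing zero only if everything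
    after it is zero.\<close>
  show ?case
  proof (cases "\<forall>y\<in>set c. y = 0")
    case True
    then have "dropWhile (\<lambda>x. x = 0) (rev c @ [x]) = dropWhile (\<lambda>x. x = 0) [x]"
      by (intro dropWhile_append2) auto
    then show ?thesis
      using Cons.prems zeros[OF True] by (cases "x = 0") (auto simp: gs)
  next
    case False
    then have "dropWhile (\<lambda>x. x = 0) (rev c @ [x]) = dropWhile (\<lambda>x. x = 0) (rev c) @ [x]"
      using dropWhile_append1[of _ "rev c" "\<lambda>x. x = 0"] by auto
    then show ?thesis using Cons.IH[of hs] Cons.prems by (simp add: gs)
  qed
qed simp

lemma frozen_set_add_rotations:
  "d \<in> frozen_set (add_rotations xs c cs) \<Longrightarrow>
    d \<in> frozen_set cs \<or> (\<exists>n. d = rev (dropWhile (\<lambda>x. x = 0) (rev (rotate n c))))"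
proof (induction xs arbitrary: c cs)
  case (Cons x xs)
  from Cons.IH[of "rotate1 c"] Cons.prems
  consider "d \<in> frozen_set (freeze (rev (dropWhile (\<lambda>x. x = 0) (rev c))) cs)"
    | n where "d = rev (dropWhile (\<lambda>x. x = 0) (rev (rotate n (rotate1 c))))"
    by auto
  then show ?case
  proof cases
    case 1
    then show ?thesis by (auto simp: freeze_def intro: exI[of _ 0])
  next
    case 2
    moreover have "rotate n (rotate1 c) = rotate (Suc n) c" by (simp add: rotate1_rotate_swap)
    ultimately show ?thesis by metis
  qed
qed simp

lemma dihedral_closure_forbidden:
  assumes "d \<in> frozen_set (dihedral_closure cs)"
    and "\<And>c. c \<in> set cs \<Longrightarrow> length c = m \<and> forbidden k c"
  shows "\<exists>c. length c = m \<and> forbidden k c \<and> d = rev (dropWhile (\<lambda>x. x = 0) (rev c))"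
  using assms
proof (induction cs)
  case (Cons c cs)
  then have c: "length c = m" "forbidden k c" by auto
  from Cons.prems(1) consider "d \<in> frozen_set (dihedral_closure cs)"
    | n where "d = rev (dropWhile (\<lambda>x. x = 0) (rev (rotate n c)))"
    | n where "d = rev (dropWhile (\<lambda>x. x = 0) (rev (rotate n (rev c))))"
    by (auto dest!: frozen_set_add_rotations)
  then show ?case
  proof cases
    case 1
    then show ?thesis using Cons by auto
  next
    case 2
    then show ?thesis using c by (intro exI[of _ "rotate n c"]) (simp add: forbidden_rotate)
  next
    case 3
    then show ?thesis
      using c by (intro exI[of _ "rotate n (rev c)"]) (simp add: forbidden_rotate forbidden_rev)
  qed
qed simp

text \<open>A rotation brings a maximal entry to the front; the search yields a core below the
  rotated list, and being forbidden passes up from the core and back along the rotation.\<close>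

lemma forbidden_if_unavoidable:
  assumes "unavoidable s cs" "cs \<noteq> []"
    and cores: "\<And>c. c \<in> set cs \<Longrightarrow> length c = m \<and> forbidden k c"
    and "m > 0" "length gs = m" "sum_list gs = s"
  shows "forbidden k gs"
proof -
  define M where "M = Max (set gs)"
  have le_M: "\<And>h. h \<in> set gs \<Longrightarrow> h \<le> M" by (simp add: M_def)
  have "M \<in> set gs" unfolding M_def using assms by (intro Max_in) auto
  then obtain xs ys where xy: "gs = xs @ M # ys" by (meson split_list)
  define hs where "hs = ys @ xs"
  have rot: "gs = rotate (length (M # ys)) (M # hs)"
    using rotate_append[of "M # ys" xs] by (simp add: xy hs_def)
  have le: "h \<le> M" if "h \<in> set hs" for h
    using that by (intro le_M) (auto simp: xy hs_def)
  have len: "length hs = m - 1" and sum: "M + sum_list hs = s"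
    using assms(5,6) by (auto simp: xy hs_def)
  have len_us: "length (tl (hd cs)) = m - 1" using cores[of "hd cs"] \<open>cs \<noteq> []\<close> by simp
  have heads: "covers (s - M) (map (\<lambda>_. M) us) (fits_after M ds Nil_frozen)"
    if "covers_max_heads Ms s us ds" "M \<in> set Ms" for Ms us ds
    using that by (induction Ms) (auto split: if_splits)
  have "\<exists>c\<in>frozen_set (fits_after M (dihedral_closure cs) Nil_frozen). dominated c hs"
  proof (rule covers_sound(1))
    show "covers (s - M) (map (\<lambda>_. M) (tl (hd cs))) (fits_after M (dihedral_closure cs) Nil_frozen)"
      using assms(1) sum unfolding unavoidable_def by (rule_tac heads) auto
    show "list_all2 (\<le>) hs (map (\<lambda>_. M) (tl (hd cs)))"
      using len len_us le by (auto simp: list_all2_conv_all_nth)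
  qed (use sum in simp)
  then obtain d where d: "d \<in> frozen_set (dihedral_closure cs)" "dominated d (M # hs)"
    using dominated_if_fits_after by blast
  obtain c where c: "length c = m" "forbidden k c" "d = rev (dropWhile (\<lambda>x. x = 0) (rev c))"
    using dihedral_closure_forbidden[OF d(1) cores] by blast
  have "list_all2 (\<le>) c (M # hs)"
    using d(2) c len \<open>m > 0\<close> by (intro list_all2_if_dominated_strip) auto
  then have "forbidden k (M # hs)" using c(2) by (rule_tac forbidden_mono)
  then show ?thesis using forbidden_rotate rot by metis
qed

section \<open>The lower bound\<close>

lemma sorted_wrt_subseq: "subseq us vs \<Longrightarrow> sorted_wrt P vs \<Longrightarrow> sorted_wrt P us"
proof (induction rule: list_emb.induct)
  case (list_emb_Cons2 x y xs ys)
  then show ?case using set_mono_subseq by fastforce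
qed auto

text \<open>The symmetric page function that \<open>book_embedding\<close> asks for; 0 is a dummy
  value for vertices of equal colour.\<close>

fun vertex_page :: "(nat \<times> nat \<Rightarrow> nat) \<Rightarrow> nat + nat \<Rightarrow> nat + nat \<Rightarrow> nat" where
  "vertex_page pg (Inl i) (Inr j) = pg (i, j)"
| "vertex_page pg (Inr j) (Inl i) = pg (i, j)"
| "vertex_page pg _ _ = 0"

text \<open>The adjacency relation to which Turan's theorem is applied.\<close>

definition star_cross :: "nat \<Rightarrow> (nat + nat \<Rightarrow> nat) \<Rightarrow> (nat \<times> nat \<Rightarrow> nat) \<Rightarrow> nat \<Rightarrow> nat \<Rightarrow> bool" where
  "star_cross m pos pg j j' \<longleftrightarrow>
     (\<exists>i<m. \<exists>i'<m. pg (i, j) = pg (i', j') \<and> edge_cross pos (i, j) (i', j'))"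

lemma interleave_commute: "interleave a b c d \<longleftrightarrow> interleave c d a b"
  by (auto simp: interleave_def Let_def)

lemma interleave_swap: "interleave b a c d = interleave a b c d" "interleave a b d c = interleave a b c d"
  by (simp_all add: interleave_def min.commute max.commute)

lemma edge_cross_commute: "edge_cross pos e f \<longleftrightarrow> edge_cross pos f e"
  unfolding edge_cross_def by (rule interleave_commute)

lemma star_cross_sym: "star_cross m pos pg j j' \<Longrightarrow> star_cross m pos pg j' j"
  unfolding star_cross_def by (metis edge_cross_commute)

lemma interleave_irrefl: "\<not> interleave a c b c"
  by (auto simp: interleave_def Let_def min_def max_def)

lemma not_star_cross_self: "\<not> star_cross m pos pg j j"
  by (simp add: star_cross_def edge_cross_def interleave_irrefl)

text \<open>Otherwise \<open>l + 1\<close> pairwise noncrossing stars, with their vertices listed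
  along the spine, would form a book embedding with a forbidden gap list.\<close>

lemma card_noncrossing_stars:
  assumes draw: "k_page_drawing k m n pos pg"
    and forb: "\<And>gs. length gs = m \<Longrightarrow> sum_list gs = Suc l \<Longrightarrow> forbidden k gs"
    and "m > 0" "I \<subseteq> {..<n}"
    and indep: "\<And>j j'. j \<in> I \<Longrightarrow> j' \<in> I \<Longrightarrow> \<not> star_cross m pos pg j j'"
  shows "card I \<le> l"
proof (rule ccontr)
  assume "\<not> card I \<le> l"
  then obtain J where J: "J \<subseteq> I" "card J = Suc l"
    by (metis not_less_eq_eq obtain_subset_with_card_n)
  define V where "V = Inl ` {..<m} \<union> Inr ` J"
  have finJ: "finite J" using J by (metis card.infinite nat.distinct(1))
  have V: "finite V" "V \<subseteq> kmn_vertices m n"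
    using J assms(4) finJ by (auto simp: V_def kmn_vertices_def)
  then have inj: "inj_on pos V"
    using draw by (auto simp: k_page_drawing_def intro: inj_on_subset)
  obtain ws where ws: "set ws = V" "distinct ws" using finite_distinct_list V(1) by blast
  define vs where "vs = sort_key pos ws"
  have vs: "set vs = V" "distinct vs" "sorted (map pos vs)"
    using ws by (simp_all add: vs_def)
  have "distinct (map pos vs)" using vs inj by (simp add: distinct_map)
  with vs(3) have sw: "sorted_wrt (<) (map pos vs)" by (simp add: strict_sorted_iff)
  have order: "sorted_wrt (<) (map pos us)" if "subseq us vs" for us
    using sorted_wrt_subseq[OF subseq_map[OF that] sw] .
  have "book_embedding k isl (vertex_page pg) vs"
    unfolding book_embedding_def
  proof (intro conjI allI ballI impI)
    show "vertex_page pg a b = vertex_page pg b a" for a b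
      by (cases a; cases b) auto
    have "pg (i, j) < k" if "i < m" "j \<in> J" for i j
      using that draw J(1) assms(4) by (auto simp: k_page_drawing_def kmn_edges_def)
    then show "vertex_page pg a b < k" if "a \<in> set vs" "b \<in> set vs" "isl a \<noteq> isl b" for a b
      using that unfolding vs(1) V_def by (cases a; cases b) auto
    fix a b c d
    assume sub: "subseq [a, b, c, d] vs" and ac: "isl a \<noteq> isl c" and bd: "isl b \<noteq> isl d"
    have ord: "pos a < pos b" "pos b < pos c" "pos c < pos d" using order[OF sub] by auto
    have "set [a, b, c, d] \<subseteq> V" using set_mono_subseq[OF sub] vs(1) by simp
    then have mem: "a \<in> V" "b \<in> V" "c \<in> V" "d \<in> V" by auto
    have edge: "\<exists>i<m. \<exists>j\<in>J. (x = Inl i \<and> y = Inr j \<or> x = Inr j \<and> y = Inl i) \<and>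
        vertex_page pg x y = pg (i, j)"
      if "x \<in> V" "y \<in> V" "isl x \<noteq> isl y" for x y
      using that unfolding V_def by (cases x; cases y) auto
    obtain i j where ij: "a = Inl i \<and> c = Inr j \<or> a = Inr j \<and> c = Inl i" "i < m" "j \<in> J"
      "vertex_page pg a c = pg (i, j)"
      using edge[OF mem(1,3) ac] by blast
    obtain i' j' where ij': "b = Inl i' \<and> d = Inr j' \<or> b = Inr j' \<and> d = Inl i'" "i' < m" "j' \<in> J"
      "vertex_page pg b d = pg (i', j')"
      using edge[OF mem(2,4) bd] by blast
    \<comment> \<open>An alternating quadruple on one page would be a crossing between stars of
      \<open>J\<close>.\<close>
    have "interleave (pos a) (pos c) (pos b) (pos d)"
      using ord by (simp add: interleave_def Let_def)
    then have "edge_cross pos (i, j) (i', j')"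
      using ij(1) ij'(1) interleave_swap unfolding edge_cross_def by auto
    then show "vertex_page pg a c \<noteq> vertex_page pg b d"
      using indep[of j j'] ij ij' J(1) by (auto simp: star_cross_def)
  qed
  moreover have "length (filter isl vs) = m"
  proof -
    have "set (filter isl vs) = Inl ` {..<m}" by (auto simp: vs(1) V_def)
    then show ?thesis
      using distinct_card[of "filter isl vs"] vs(2) by (simp add: card_image)
  qed
  moreover have "length (filter (\<lambda>v. \<not> isl v) vs) = Suc l"
  proof -
    have "set (filter (\<lambda>v. \<not> isl v) vs) = Inr ` J" by (auto simp: vs(1) V_def)
    then show ?thesis
      using distinct_card[of "filter (\<lambda>v. \<not> isl v) vs"] vs(2) J(2) by (simp add: card_image)
  qed
  ultimately show False
    using not_book_embedding_if_forbidden[OF forb \<open>m > 0\<close>] by blast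
qed

text \<open>Taking the blue endpoints of two crossing edges maps the crossings onto the pairs of
  crossing stars.\<close>

lemma star_crossings_le_crossings:
  "card {{x, y} | x y. x \<in> {..<n} \<and> y \<in> {..<n} \<and> x \<noteq> y \<and> star_cross m pos pg x y}
    \<le> crossings m n pos pg"
  unfolding crossings_def
proof (rule surj_card_le)
  let ?C = "{{e, f} | e f. e \<in> kmn_edges m n \<and> f \<in> kmn_edges m n \<and> pg e = pg f \<and> edge_cross pos e f}"
  show "finite ?C"
    by (rule finite_subset[of _ "Pow (kmn_edges m n)"]) (auto simp: kmn_edges_def)
  show "{{x, y} | x y. x \<in> {..<n} \<and> y \<in> {..<n} \<and> x \<noteq> y \<and> star_cross m pos pg x y}
    \<subseteq> (\<lambda>X. snd ` X) ` ?C"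
  proof clarify
    fix x y assume xy: "x < n" "y < n" "star_cross m pos pg x y"
    then obtain i i' where "i < m" "i' < m" "pg (i, x) = pg (i', y)" "edge_cross pos (i, x) (i', y)"
      by (auto simp: star_cross_def)
    with xy have "{(i, x), (i', y)} \<in> ?C" by (auto simp: kmn_edges_def)
    then show "{x, y} \<in> (\<lambda>X. snd ` X) ` ?C" by (rule rev_image_eqI) auto
  qed
qed

lemma crossings_ge:
  assumes "k_page_drawing k m n pos pg" "m > 0"
    and "\<And>gs. length gs = m \<Longrightarrow> sum_list gs = Suc l \<Longrightarrow> forbidden k gs"
  shows "(\<Sum>i<n. i div l) \<le> crossings m n pos pg"
proof -
  have "(\<Sum>i<card {..<n}. i div l) \<le>
      card {{x, y} | x y. x \<in> {..<n} \<and> y \<in> {..<n} \<and> x \<noteq> y \<and> star_cross m pos pg x y}"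
  proof (rule edges_ge_if_independent_sets_small)
    fix I assume "I \<subseteq> {..<n}"
      and "\<And>x y. x \<in> I \<Longrightarrow> y \<in> I \<Longrightarrow> x \<noteq> y \<Longrightarrow> \<not> star_cross m pos pg x y"
    then show "card I \<le> l"
      using card_noncrossing_stars[OF assms(1,3,2)] not_star_cross_self by metis
  qed (auto intro: star_cross_sym)
  also have "\<dots> \<le> crossings m n pos pg" by (rule star_crossings_le_crossings)
  finally show ?thesis by simp
qed

section \<open>The upper bound\<close>

text \<open>For red \<open>r\<close>, \<open>r'\<close> and blue \<open>v < v'\<close>, the
  right-hand side compares only red with blue and red with red positions, which the drawing below
  makes explicit.\<close>

lemma interleave_iff:
  assumes "v < v'" "r \<noteq> v" "r \<noteq> v'" "r' \<noteq> v" "r' \<noteq> v'"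
  shows "interleave r v r' v' \<longleftrightarrow>
    (if r < v then r < r' \<and> r' < v else (v' < r \<and> (r' < v \<or> r < r')) \<or> (r < v' \<and> v < r' \<and> r' < r))"
  using assms by (auto simp: interleave_def Let_def min_def max_def)

text \<open>The red vertices are \<open>0, \<dots>, k = p + s - 1\<close>. In each of the gaps after the red vertices
  \<open>0, \<dots>, p - 1\<close> there are \<open>s\<close> classes of blue vertices, \<open>(g, t)\<close> being the class number \<open>t\<close> in the
  gap \<open>g\<close>. A vertex of this class uses the pages \<open>g, g + 1, \<dots>\<close> modulo \<open>k\<close> in turn, but uses the
  same page for the cyclically consecutive red vertices \<open>p + t\<close> and \<open>p + t + 1\<close>.\<close>

definition class_page :: "nat \<Rightarrow> nat \<Rightarrow> nat \<Rightarrow> nat \<Rightarrow> nat \<Rightarrow> nat" where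
  "class_page k p i g t = (g + i - (if p + t < i then 1 else 0)) mod k"

lemma mod_eq_cases:
  fixes x y k :: nat
  assumes "x mod k = y mod k" "x < 2 * k" "y < 2 * k"
  shows "x = y \<or> x = y + k \<or> y = x + k"
proof -
  have "z mod k = (if z < k then z else z - k)" if "z < 2 * k" for z
    using that by (simp add: mod_if)
  then show ?thesis using assms by (auto split: if_splits)
qed

text \<open>Before reduction modulo \<open>k\<close> the page numbers are below
  \<open>2 * k\<close>, so equal pages mean equality up to a shift by \<open>k\<close>. With the
  crossing pattern this leaves two members of one class, meeting at the two red vertices that share
  a page.\<close>

lemma class_page_crossing:
  assumes "k > 0" "p + s = k + 1" "p \<le> s" and i: "i \<le> k" "i' \<le> k"
    and "g < p" "g' < p" "t < s" "t' < s"
    and le: "g < g' \<or> g = g' \<and> t \<le> t'"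
    and page: "class_page k p i g t = class_page k p i' g' t'"
    and cross: "if i \<le> g then i < i' \<and> i' \<le> g
      else (g' < i \<and> (i' \<le> g \<or> i < i')) \<or> (i \<le> g' \<and> g < i' \<and> i' < i)"
  shows "g = g' \<and> t = t' \<and> i = p + t \<and> i' = (if p + t < k then p + t + 1 else 0)"
proof -
  define d d' :: nat where "d = (if p + t < i then 1 else 0)" and "d' = (if p + t' < i' then 1 else 0)"
  then have d: "d = 0 \<and> i \<le> p + t \<or> d = 1 \<and> p + t < i" "d' = 0 \<and> i' \<le> p + t' \<or> d' = 1 \<and> p + t' < i'"
    by auto
  have "g + i - d = g' + i' - d' \<or> g + i - d = g' + i' - d' + k \<or> g' + i' - d' = g + i - d + k"
  proof (rule mod_eq_cases)
    show "(g + i - d) mod k = (g' + i' - d') mod k"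
      using page by (simp add: class_page_def d_def d'_def)
    show "g + i - d < 2 * k" "g' + i' - d' < 2 * k" using assms(1-10) d by linarith+
  qed
  \<comment> \<open>Makes the truncated subtractions exact, so that they can be moved to the other
    side.\<close>
  moreover have "d \<le> g + i" "d' \<le> g' + i'" using d by auto
  ultimately have xy: "g + i + d' = g' + i' + d \<or> g + i + d' = g' + i' + d + k \<or>
      g' + i' + d = g + i + d' + k" by linarith
  from cross consider "i \<le> g" "i < i'" "i' \<le> g" | "g < i" "g' < i" "i' \<le> g"
    | "g < i" "g' < i" "i < i'" | "g < i" "i \<le> g'" "g < i'" "i' < i"
    by (auto split: if_splits)
  \<comment> \<open>The first and the last pattern are contradictory; the second leaves
    \<open>i' = 0\<close>, the third \<open>i' = i + 1\<close>.\<close>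
  then have "g = g' \<and> t = t' \<and> i = p + t \<and> (p + t < k \<and> i' = p + t + 1 \<or> p + t = k \<and> i' = 0)"
    by cases (use assms(1-10) d xy in \<open>(elim disjE conjE; linarith)+\<close>)
  then show ?thesis by auto
qed

locale clumped_drawing =
  fixes k p s n :: nat
  assumes k: "k > 0" and ps: "p + s = k + 1" "p \<le> s" "p > 0"
begin

text \<open>Blue vertices congruent modulo \<open>p * s\<close> are clones, which makes the class
  sizes differ by at most one.\<close>

definition gap :: "nat \<Rightarrow> nat" where "gap j = (j mod (p * s)) div s"
definition slot :: "nat \<Rightarrow> nat" where "slot j = (j mod (p * s)) mod s"
text \<open>One place for a red vertex and \<open>n\<close> places for each of the \<open>s\<close>
  slots after it.\<close>

definition width :: nat where "width = Suc (s * n)"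

definition place :: "nat + nat \<Rightarrow> nat" where
  "place v = (case v of Inl i \<Rightarrow> i * width | Inr j \<Rightarrow> gap j * width + Suc (slot j * n + j))"

definition page :: "nat \<times> nat \<Rightarrow> nat" where
  "page e = class_page k p (fst e) (gap (snd e)) (slot (snd e))"

lemma width_pos: "0 < width"
  by (simp add: width_def)

lemma gap_less: "gap j < p" and slot_less: "slot j < s"
  using ps by (simp_all add: gap_def slot_def less_mult_imp_div_less)

lemma same_class_iff: "gap i = gap j \<and> slot i = slot j \<longleftrightarrow> i mod (p * s) = j mod (p * s)"
  unfolding gap_def slot_def by (metis div_mult_mod_eq)

lemma offset_less: "j < n \<Longrightarrow> Suc (slot j * n + j) < width"
proof -
  assume "j < n"
  then have "slot j * n + j < Suc (slot j) * n" by simp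
  also have "\<dots> \<le> s * n" using slot_less[of j] by (intro mult_le_mono1) simp
  finally show ?thesis by (simp add: width_def)
qed

lemma place_Inl_less_Inr: "j < n \<Longrightarrow> place (Inl i) < place (Inr j) \<longleftrightarrow> i \<le> gap j"
  and place_Inr_less_Inl: "j < n \<Longrightarrow> place (Inr j) < place (Inl i) \<longleftrightarrow> gap j < i"
proof -
  assume j: "j < n"
  have "place (Inl i) < place (Inr j)" if "i \<le> gap j"
    using mult_le_mono1[OF that, of width] unfolding place_def sum.case by linarith
  moreover have "place (Inr j) < place (Inl i)" if "gap j < i"
    using mult_le_mono1[of "Suc (gap j)" i width] that offset_less[OF j] by (simp add: place_def)
  ultimately show "place (Inl i) < place (Inr j) \<longleftrightarrow> i \<le> gap j"
    "place (Inr j) < place (Inl i) \<longleftrightarrow> gap j < i"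
    by (meson leI less_asym')+
qed

lemma place_Inl_less_Inl: "place (Inl i) < place (Inl i') \<longleftrightarrow> i < i'"
  by (simp add: place_def width_pos)

lemma class_le_if_place_less:
  assumes "j < n" "j' < n" "place (Inr j) < place (Inr j')"
  shows "gap j < gap j' \<or> gap j = gap j' \<and> slot j \<le> slot j'"
proof -
  have "\<not> gap j' < gap j"
    using assms place_Inr_less_Inl[of j' "gap j"] place_Inl_less_Inr[of j "gap j"] by auto
  moreover have "\<not> slot j' < slot j" if "gap j = gap j'"
  proof
    assume "slot j' < slot j"
    then have "Suc (slot j') * n \<le> slot j * n" by (intro mult_le_mono1) simp
    then show False using assms that by (simp add: place_def)
  qed
  ultimately show ?thesis by linarith
qed

lemma place_less_same_class:
  "j mod (p * s) = j' mod (p * s) \<Longrightarrow> place (Inr j) < place (Inr j') \<longleftrightarrow> j < j'"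
  by (simp add: place_def gap_def slot_def)

lemma inj_place: "inj_on place (kmn_vertices (k + 1) n)"
proof (rule inj_onI)
  fix u v assume uv: "u \<in> kmn_vertices (k + 1) n" "v \<in> kmn_vertices (k + 1) n" "place u = place v"
  have mixed: "place (Inl i) \<noteq> place (Inr j)" if "j < n" for i j
    using place_Inl_less_Inr[OF that, of i] place_Inr_less_Inl[OF that, of i] by linarith
  have blue: "j = j'" if j: "j < n" "j' < n" and eq: "place (Inr j) = place (Inr j')" for j j'
  proof -
    have "gap j = gap j'"
      using j eq place_Inl_less_Inr[of j "gap j"] place_Inl_less_Inr[of j' "gap j"]
        place_Inl_less_Inr[of j "gap j'"] place_Inl_less_Inr[of j' "gap j'"] by auto
    then have "slot j * n + j = slot j' * n + j'" using eq by (simp add: place_def)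
    \<comment> \<open>Within a gap, \<open>j\<close> is recovered from the offset as its residue
      modulo \<open>n\<close>.\<close>
    then have "(j + slot j * n) mod n = (j' + slot j' * n) mod n" by (simp add: add.commute)
    then show ?thesis using j by simp
  qed
  have red: "i = i'" if "place (Inl i) = place (Inl i')" for i i'
    using that place_Inl_less_Inl[of i i'] place_Inl_less_Inl[of i' i] by linarith
  show "u = v"
    using uv
    by (cases u; cases v) (auto simp: kmn_vertices_def mixed mixed[symmetric] dest: red blue)
qed

lemma drawing: "k_page_drawing k (k + 1) n place page"
  using inj_place k by (simp add: k_page_drawing_def page_def class_page_def)

text \<open>\<open>first_red j\<close> and \<open>second_red j\<close> are the cyclically
  consecutive red vertices whose edges to \<open>j\<close> share a page.\<close>

definition first_red :: "nat \<Rightarrow> nat" where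
  "first_red j = p + slot j"
definition second_red :: "nat \<Rightarrow> nat" where
  "second_red j = (if p + slot j < k then p + slot j + 1 else 0)"

lemma crossing_cases:
  assumes "(i, j) \<in> kmn_edges (k + 1) n" "(i', j') \<in> kmn_edges (k + 1) n"
    and "page (i, j) = page (i', j')" "edge_cross place (i, j) (i', j')"
    and less: "place (Inr j) < place (Inr j')"
  shows "j mod (p * s) = j' mod (p * s) \<and> i = first_red j \<and> i' = second_red j"
proof -
  have b: "i \<le> k" "i' \<le> k" "j < n" "j' < n" using assms(1,2) by (auto simp: kmn_edges_def)
  have ne: "place (Inl a) \<noteq> place (Inr c)" if "c < n" for a c
    using place_Inl_less_Inr[OF that, of a] place_Inr_less_Inl[OF that, of a] by linarith
  have cross: "if i \<le> gap j then i < i' \<and> i' \<le> gap j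
      else (gap j' < i \<and> (i' \<le> gap j \<or> i < i')) \<or> (i \<le> gap j' \<and> gap j < i' \<and> i' < i)"
    using assms(4) unfolding edge_cross_def fst_conv snd_conv
      interleave_iff[OF less ne[OF b(3)] ne[OF b(4)] ne[OF b(3)] ne[OF b(4)]]
      place_Inl_less_Inr[OF b(3)] place_Inl_less_Inr[OF b(4)]
      place_Inr_less_Inl[OF b(3)] place_Inr_less_Inl[OF b(4)] place_Inl_less_Inl .
  have "gap j = gap j' \<and> slot j = slot j' \<and> i = first_red j \<and> i' = second_red j"
    unfolding first_red_def second_red_def
    by (rule class_page_crossing[OF k ps(1,2) b(1,2) gap_less gap_less slot_less slot_less
          class_le_if_place_less[OF b(3,4) less] _ cross]) (use assms(3) in \<open>simp add: page_def\<close>)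
  then show ?thesis using same_class_iff by auto
qed

text \<open>A crossing is determined by its two blue endpoints, which are clones, so the crossings
  inject into the congruent pairs.\<close>

lemma crossings_le: "crossings (k + 1) n place page \<le> (\<Sum>j<n. j div (p * s))"
proof -
  let ?C = "{{e, f} | e f. e \<in> kmn_edges (k + 1) n \<and> f \<in> kmn_edges (k + 1) n \<and>
    page e = page f \<and> edge_cross place e f}"
  let ?P = "{{j, j'} | j j'. j < j' \<and> j' < n \<and> j mod (p * s) = j' mod (p * s)}"
  have C: "\<exists>j j'. j < j' \<and> j' < n \<and> j mod (p * s) = j' mod (p * s) \<and>
      X = {(first_red j, j), (second_red j, j')}" if "X \<in> ?C" for X
  proof -
    from that obtain e f where ef: "X = {e, f}" "e \<in> kmn_edges (k + 1) n" "f \<in> kmn_edges (k + 1) n"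
      "page e = page f" "edge_cross place e f" by blast
    obtain i j i' j' where e: "e = (i, j)" "f = (i', j')" by (cases e; cases f)
    have bnd: "j < n" "j' < n" using ef e by (auto simp: kmn_edges_def)
    have "j \<noteq> j'" using ef(5) by (auto simp: e edge_cross_def interleave_irrefl)
    then have "place (Inr j) \<noteq> place (Inr j')"
      using inj_onD[OF inj_place, of "Inr j" "Inr j'"] bnd by (auto simp: kmn_vertices_def)
    then consider "place (Inr j) < place (Inr j')" | "place (Inr j') < place (Inr j)" by linarith
    then show ?thesis
    proof cases
      case 1
      have "j mod (p * s) = j' mod (p * s) \<and> i = first_red j \<and> i' = second_red j"
        by (rule crossing_cases[OF _ _ _ _ 1]) (use ef(2-5) in \<open>simp_all add: e\<close>)
      moreover from this have "j < j'" using 1 place_less_same_class by blast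
      ultimately show ?thesis
        using ef(1) bnd(2) by (intro exI[of _ j] exI[of _ j']) (simp add: e)
    next
      case 2
      have "j' mod (p * s) = j mod (p * s) \<and> i' = first_red j' \<and> i = second_red j'"
        by (rule crossing_cases[OF _ _ _ _ 2])
          (use ef(2-4) edge_cross_commute[THEN iffD1, OF ef(5)] in \<open>simp_all add: e\<close>)
      moreover from this have "j' < j" using 2 place_less_same_class by blast
      ultimately show ?thesis
        using ef(1) bnd(1) by (intro exI[of _ j'] exI[of _ j]) (simp add: e insert_commute)
    qed
  qed
  have "card ?C \<le> card ?P"
  proof (rule card_inj_on_le)
    \<comment> \<open>Clones lie along the spine in the order of their indices, so the smaller index
      belongs to the edge at \<open>first_red\<close>.\<close>
    let ?inv = "\<lambda>A. {(first_red (Min A), Min A), (second_red (Min A), Max A)}"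
    have "?inv (snd ` X) = X" if X: "X \<in> ?C" for X
    proof -
      from C[OF X] obtain j j' where jj: "j < j'" "X = {(first_red j, j), (second_red j, j')}"
        by blast
      then have "snd ` X = {j, j'}" by simp
      moreover have "Min {j, j'} = j" "Max {j, j'} = j'" using jj(1) by simp_all
      ultimately show ?thesis using jj(2) by simp
    qed
    then show "inj_on (\<lambda>X. snd ` X) ?C" by (rule inj_on_inverseI)
    show "(\<lambda>X. snd ` X) ` ?C \<subseteq> ?P"
    proof
      fix A assume "A \<in> (\<lambda>X. snd ` X) ` ?C"
      then obtain X where "X \<in> ?C" "A = snd ` X" by blast
      with C[OF this(1)] obtain j j' where jj: "j < j'" "j' < n" "j mod (p * s) = j' mod (p * s)"
        "A = snd ` {(first_red j, j), (second_red j, j')}" by blast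
      then have "A = {j, j'}" by simp
      with jj show "A \<in> ?P" by blast
    qed
    show "finite ?P"
      by (rule finite_subset[of _ "Pow {..<n}"]) auto
  qed
  also have "\<dots> \<le> (\<Sum>j<n. j div (p * s))"
    using card_congruent_pairs_le[of "p * s" n] ps by simp
  finally show ?thesis by (simp add: crossings_def)
qed

end

lemma book_crossing_eq:
  assumes "k > 0" and "l = (k + 1)\<^sup>2 div 4"
    and forb: "\<And>gs. length gs = k + 1 \<Longrightarrow> sum_list gs = Suc l \<Longrightarrow> forbidden k gs"
  shows "book_crossing_Kmn k (k + 1) n = (\<Sum>i<n. i div l)"
proof -
  \<comment> \<open>The two halves of \<open>k + 1\<close>, rounded down and up; their product is
    \<open>l\<close>.\<close>
  define p s where "p = (k + 1) div 2" and "s = k + 1 - p"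
  interpret clumped_drawing k p s n
    by unfold_locales (use assms(1) in \<open>auto simp: p_def s_def\<close>)
  have "(k + 1)\<^sup>2 div 4 = p * s"
  proof (cases "even (k + 1)")
    case True
    then obtain a where "k + 1 = 2 * a" by blast
    then show ?thesis by (simp add: p_def s_def power2_eq_square)
  next
    case False
    then obtain a where "k + 1 = 2 * a + 1" by (rule oddE)
    then show ?thesis by (simp add: p_def s_def power2_eq_square algebra_simps)
  qed
  then have "crossings (k + 1) n place page \<le> (\<Sum>i<n. i div l)"
    using crossings_le assms(2) by simp
  moreover have ge: "(\<Sum>i<n. i div l) \<le> crossings (k + 1) n pos pg"
    if "k_page_drawing k (k + 1) n pos pg" for pos pg
    using crossings_ge[OF that _ forb] by simp
  ultimately have "crossings (k + 1) n place page = (\<Sum>i<n. i div l)"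
    using drawing by (simp add: le_antisym)
  then show ?thesis
    unfolding book_crossing_Kmn_def
    by (intro Least_equality) (use drawing ge in blast)+
qed

section \<open>The cases \<open>k = 2, \<dots>, 6\<close>\<close>

text \<open>Each entry consists of a gap list and of heavy edges certifying that it is forbidden. They were
  found by computing fractional chromatic numbers of the conflict graphs of the edges.\<close>

definition cores3 :: "(nat list \<times> (nat \<times> nat) list) list" where
  "cores3 = [
    ([3, 0, 0], [
      (0, 3), (1, 4), (2, 5)]),
    ([2, 1, 0], [
      (0, 2), (0, 4), (1, 3), (1, 5), (2, 5)]),
    ([1, 1, 1], [
      (0, 3), (1, 4), (2, 5)])]"

definition cores4 :: "(nat list \<times> (nat \<times> nat) list) list" where
  "cores4 = [
    ([2, 1, 1, 0], [
      (0, 2), (0, 4), (0, 6), (1, 3), (1, 5), (1, 7), (2, 5), (2, 7), (3, 6), (4, 7)]),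
    ([3, 1, 0, 0], [
      (0, 3), (0, 5), (1, 4), (1, 6), (2, 6), (2, 7), (3, 7)]),
    ([4, 0, 0, 0], [
      (0, 4), (1, 5), (2, 6), (3, 7)]),
    ([3, 0, 2, 0], [
      (0, 2), (0, 3), (0, 6), (0, 7), (1, 4), (1, 5), (1, 8), (2, 4), (2, 5), (2, 8), (3, 5),
      (3, 8), (4, 6), (4, 7), (5, 7), (6, 8)])]"

definition cores5 :: "(nat list \<times> (nat \<times> nat) list) list" where
  "cores5 = [
    ([4, 1, 0, 0, 0], [
      (0, 4), (0, 6), (1, 5), (1, 7), (2, 7), (2, 8), (3, 8), (3, 9), (4, 9)]),
    ([2, 1, 1, 1, 0], [
      (0, 2), (0, 4), (0, 6), (0, 8), (1, 3), (1, 5), (1, 7), (1, 9), (2, 5), (2, 7), (2, 9),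
      (3, 6), (3, 8), (4, 7), (4, 9), (5, 8), (6, 9)]),
    ([5, 0, 0, 0, 0], [
      (0, 5), (1, 6), (2, 7), (3, 8), (4, 9)]),
    ([2, 2, 0, 1, 0], [
      (0, 5), (1, 6), (2, 7), (3, 8), (4, 9)]),
    ([3, 2, 1, 0, 0], [
      (0, 3), (0, 6), (0, 8), (1, 4), (1, 7), (1, 9), (2, 10), (3, 7), (3, 9), (4, 8), (5, 9),
      (5, 10), (6, 10)]),
    ([4, 0, 2, 1, 0], [
      (0, 4), (0, 8), (1, 5), (1, 9), (2, 6), (3, 11), (4, 9), (6, 10), (7, 11)]),
    ([3, 1, 0, 3, 0], [
      (0, 3), (0, 9), (1, 4), (1, 7), (2, 6), (2, 11), (3, 7), (4, 8), (4, 10), (5, 11), (6, 9),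
      (7, 10), (8, 11)]),
    ([3, 1, 2, 0, 0], [
      (0, 3), (0, 5), (0, 8), (1, 4), (1, 6), (1, 9), (2, 6), (2, 9), (2, 10), (3, 10), (4, 8),
      (5, 9), (7, 10)]),
    ([3, 1, 0, 0, 1], [
      (0, 5), (1, 6), (2, 7), (3, 8), (4, 9)]),
    ([4, 0, 3, 0, 0], [
      (0, 3), (0, 4), (0, 8), (0, 9), (1, 5), (1, 6), (1, 10), (2, 5), (2, 6), (2, 10), (2, 11),
      (3, 6), (3, 10), (3, 11), (4, 11), (5, 8), (5, 9), (6, 9), (7, 10), (7, 11), (8, 11)])]"

definition cores6 :: "(nat list \<times> (nat \<times> nat) list) list" where
  "cores6 = [
    ([3, 2, 0, 0, 1, 0], [
      (0, 6), (1, 7), (2, 8), (3, 9), (4, 10), (5, 11)]),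
    ([5, 1, 0, 0, 0, 0], [
      (0, 5), (0, 7), (1, 6), (1, 8), (2, 8), (2, 9), (3, 9), (3, 10), (4, 10), (4, 11), (5, 11)]),
    ([4, 0, 2, 0, 1, 0], [
      (0, 4), (0, 8), (1, 5), (1, 9), (2, 6), (2, 10), (3, 9), (3, 12), (4, 10), (5, 11), (7, 12)]),
    ([2, 1, 1, 1, 0, 1], [
      (0, 4), (0, 8), (1, 5), (1, 9), (2, 7), (2, 10), (3, 8), (3, 11), (4, 9), (6, 10), (7, 11)]),
    ([6, 0, 0, 0, 0, 0], [
      (0, 6), (1, 7), (2, 8), (3, 9), (4, 10), (5, 11)]),
    ([3, 1, 2, 1, 0, 0], [
      (0, 3), (0, 5), (0, 8), (0, 10), (1, 4), (1, 6), (1, 9), (1, 11), (2, 6), (2, 11), (2, 12),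
      (3, 9), (3, 12), (4, 8), (4, 10), (5, 9), (5, 11), (6, 10), (7, 11), (7, 12), (8, 12)]),
    ([4, 1, 0, 0, 0, 1], [
      (0, 6), (1, 7), (2, 8), (3, 9), (4, 10), (5, 11)]),
    ([4, 1, 0, 4, 0, 0], [
      (0, 4), (0, 6), (0, 10), (0, 12), (1, 5), (1, 7), (1, 13), (2, 7), (2, 8), (3, 8), (3, 13),
      (3, 14), (4, 14), (5, 10), (5, 12), (6, 13), (7, 11), (8, 12), (9, 14), (10, 13), (11, 14)]),
    ([4, 0, 4, 0, 0, 0], [
      (0, 4), (0, 8), (0, 10), (1, 5), (1, 11), (2, 6), (2, 12), (3, 11), (3, 13), (4, 12), (5, 9),
      (6, 10), (7, 11), (7, 13), (8, 12), (9, 13)]),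
    ([5, 0, 1, 3, 0, 0], [
      (0, 4), (0, 5), (0, 8), (0, 12), (1, 6), (1, 9), (1, 13), (2, 6), (2, 7), (3, 7), (3, 9),
      (3, 13), (3, 14), (4, 9), (4, 13), (4, 14), (5, 14), (6, 11), (7, 12), (8, 13), (10, 14)]),
    ([2, 0, 2, 0, 2, 0], [
      (0, 6), (1, 7), (2, 8), (3, 9), (4, 10), (5, 11)]),
    ([4, 2, 2, 0, 0, 0], [
      (0, 4), (0, 7), (0, 10), (1, 5), (1, 8), (1, 11), (2, 11), (2, 12), (3, 12), (3, 13), (4, 8),
      (5, 9), (6, 11), (6, 13), (7, 12), (9, 13)]),
    ([5, 0, 0, 4, 0, 0], [
      (0, 4), (0, 5), (0, 10), (0, 11), (1, 6), (1, 7), (2, 6), (2, 7), (2, 8), (2, 13), (3, 7),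
      (3, 8), (3, 13), (3, 14), (4, 8), (4, 13), (4, 14), (5, 14), (6, 10), (6, 11), (7, 11),
      (7, 12), (8, 12), (9, 13), (9, 14), (10, 14)])]"

definition cores7 :: "(nat list \<times> (nat \<times> nat) list) list" where
  "cores7 = [
    ([4, 2, 0, 0, 0, 1, 0], [
      (0, 7), (1, 8), (2, 9), (3, 10), (4, 11), (5, 12), (6, 13)]),
    ([6, 1, 0, 0, 0, 0, 0], [
      (0, 6), (0, 8), (1, 7), (1, 9), (2, 9), (2, 10), (3, 10), (3, 11), (4, 11), (4, 12), (5, 12),
      (5, 13), (6, 13)]),
    ([3, 0, 2, 0, 0, 2, 0], [
      (0, 7), (1, 8), (2, 9), (3, 10), (4, 11), (5, 12), (6, 13)]),
    ([3, 3, 0, 0, 1, 0, 0], [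
      (0, 7), (1, 8), (2, 9), (3, 10), (4, 11), (5, 12), (6, 13)]),
    ([7, 0, 0, 0, 0, 0, 0], [
      (0, 7), (1, 8), (2, 9), (3, 10), (4, 11), (5, 12), (6, 13)]),
    ([4, 1, 1, 0, 0, 0, 1], [
      (0, 6), (0, 8), (1, 7), (1, 9), (2, 9), (2, 10), (3, 10), (3, 11), (4, 11), (4, 12), (5, 13),
      (6, 12), (7, 13)]),
    ([2, 2, 0, 2, 0, 1, 0], [
      (0, 5), (0, 9), (1, 6), (1, 10), (2, 7), (2, 11), (3, 8), (3, 12), (4, 10), (4, 13), (5, 11),
      (6, 12), (8, 13)]),
    ([5, 0, 2, 0, 2, 0, 0], [
      (0, 5), (0, 9), (1, 6), (1, 10), (2, 7), (2, 11), (3, 10), (3, 14), (4, 15), (5, 11), (6, 12),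
      (7, 13), (8, 15)]),
    ([4, 2, 0, 4, 0, 0, 0], [
      (0, 4), (0, 7), (0, 11), (0, 13), (1, 8), (1, 14), (2, 5), (2, 9), (2, 15), (3, 8), (3, 14),
      (3, 16), (4, 9), (4, 15), (5, 10), (5, 12), (6, 14), (6, 16), (7, 15), (8, 12), (9, 13),
      (10, 14), (10, 16), (11, 15), (12, 16)]),
    ([5, 0, 3, 0, 1, 0, 0], [
      (0, 5), (0, 10), (1, 6), (1, 11), (2, 7), (2, 12), (3, 11), (3, 14), (4, 15), (5, 12),
      (6, 13), (8, 14), (9, 15)]),
    ([4, 1, 0, 2, 3, 0, 0], [
      (0, 4), (0, 6), (0, 10), (0, 12), (0, 14), (1, 5), (1, 7), (1, 11), (2, 7), (2, 8), (2, 15),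
      (3, 8), (3, 15), (3, 16), (4, 11), (4, 16), (5, 10), (5, 12), (5, 14), (6, 11), (6, 15),
      (7, 12), (7, 13), (8, 13), (8, 14), (9, 15), (9, 16), (10, 16), (11, 14), (12, 15), (13, 16)]),
    ([5, 1, 0, 0, 5, 0, 0], [
      (0, 5), (0, 7), (0, 12), (0, 13), (1, 6), (1, 8), (2, 8), (2, 9), (3, 9), (3, 10), (3, 16),
      (4, 10), (4, 16), (4, 17), (5, 17), (6, 12), (6, 13), (8, 13), (8, 14), (9, 14), (9, 15),
      (10, 15), (11, 16), (11, 17), (12, 17)]),
    ([4, 2, 2, 2, 0, 0, 0], [
      (0, 4), (0, 6), (0, 10), (0, 13), (1, 5), (1, 8), (1, 11), (1, 14), (2, 14), (2, 15), (3, 8),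
      (3, 11), (3, 15), (3, 16), (4, 11), (4, 16), (5, 12), (5, 13), (6, 14), (7, 15), (8, 13),
      (9, 14), (9, 16), (10, 15), (12, 16)]),
    ([5, 0, 1, 2, 2, 0, 0], [
      (0, 5), (0, 11), (1, 6), (1, 12), (2, 7), (3, 9), (3, 15), (4, 16), (5, 12), (6, 13), (7, 14),
      (8, 15), (10, 16)]),
    ([5, 0, 1, 0, 5, 0, 0], [
      (0, 5), (0, 13), (1, 6), (1, 9), (2, 7), (2, 10), (3, 16), (4, 9), (4, 17), (5, 10), (6, 11),
      (6, 14), (7, 13), (7, 15), (8, 16), (9, 14), (10, 15), (11, 16), (12, 17)]),
    ([5, 3, 2, 0, 0, 0, 0], [
      (0, 5), (0, 9), (0, 12), (1, 13), (2, 6), (2, 14), (3, 10), (3, 15), (4, 13), (4, 16),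
      (5, 10), (5, 14), (6, 12), (7, 13), (7, 15), (8, 14), (8, 16), (9, 15), (11, 16)]),
    ([5, 1, 0, 0, 0, 0, 1], [
      (0, 7), (1, 8), (2, 9), (3, 10), (4, 11), (5, 12), (6, 13)])]"

lemma certificate_cores3: "list_all (certificate 2) cores3"
  by code_simp

lemma certificate_cores4: "list_all (certificate 3) cores4"
  by code_simp

lemma certificate_cores5: "list_all (certificate 4) cores5"
  by code_simp

lemma certificate_cores6: "list_all (certificate 5) cores6"
  by code_simp

lemma certificate_cores7: "list_all (certificate 6) cores7"
  by code_simp

text \<open>Here and below the sum is \<open>Suc ((k + 1)^2 div 4)\<close> for
  \<open>k = 2, ..., 6\<close>, one blue vertex more than fits without crossings.\<close>

lemma unavoidable_cores3: "unavoidable 3 (map fst cores3)"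
  by (simp add: unavoidable_def cores3_def upt_rec freeze_def cong: Frozen_cong)

lemma unavoidable_cores4: "unavoidable 5 (map fst cores4)"
  by (simp add: unavoidable_def cores4_def upt_rec freeze_def cong: Frozen_cong)

lemma unavoidable_cores5: "unavoidable 7 (map fst cores5)"
  by (simp add: unavoidable_def cores5_def upt_rec freeze_def cong: Frozen_cong)

lemma unavoidable_cores6: "unavoidable 10 (map fst cores6)"
  by (simp add: unavoidable_def cores6_def upt_rec freeze_def cong: Frozen_cong)

lemma unavoidable_cores7: "unavoidable 13 (map fst cores7)"
  by (simp add: unavoidable_def cores7_def upt_rec freeze_def cong: Frozen_cong)

lemma forbidden_if_cores:
  assumes "list_all (certificate k) cs" "list_all (\<lambda>c. length (fst c) = k + 1) cs"
    and "unavoidable (Suc l) (map fst cs)" "cs \<noteq> []"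
    and "length gs = k + 1" "sum_list gs = Suc l"
  shows "forbidden k gs"
proof (rule forbidden_if_unavoidable[OF assms(3)])
  show "length c = k + 1 \<and> forbidden k c" if "c \<in> set (map fst cs)" for c
    using that assms(1,2) forbidden_if_certificate by (fastforce simp: list_all_iff)
qed (use assms in auto)

lemma forbidden_gap_lists:
  assumes "k \<in> {2, 3, 4, 5, 6}" "length gs = k + 1" "sum_list gs = Suc ((k + 1)\<^sup>2 div 4)"
  shows "forbidden k gs"
proof -
  consider "k = 2" | "k = 3" | "k = 4" | "k = 5" | "k = 6" using assms(1) by auto
  then show ?thesis
  proof cases
    case 1
    then show ?thesis
      using forbidden_if_cores[of k cores3 2 gs] assms(2,3) certificate_cores3 unavoidable_cores3
      by (simp add: cores3_def)
  next
    case 2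
    then show ?thesis
      using forbidden_if_cores[of k cores4 4 gs] assms(2,3) certificate_cores4 unavoidable_cores4
      by (simp add: cores4_def)
  next
    case 3
    then show ?thesis
      using forbidden_if_cores[of k cores5 6 gs] assms(2,3) certificate_cores5 unavoidable_cores5
      by (simp add: cores5_def)
  next
    case 4
    then show ?thesis
      using forbidden_if_cores[of k cores6 9 gs] assms(2,3) certificate_cores6 unavoidable_cores6
      by (simp add: cores6_def)
  next
    case 5
    then show ?thesis
      using forbidden_if_cores[of k cores7 12 gs] assms(2,3) certificate_cores7 unavoidable_cores7
      by (simp add: cores7_def)
  qed
qed

theorem theorem4:
  fixes k n :: nat
  assumes "k \<in> {2,3,4,5,6}" and "n > 0"
  defines "l \<equiv> (k + 1)^2 div 4"
  defines "q \<equiv> n mod l"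
  shows "book_crossing_Kmn k (k + 1) n =
           q * (((n - q) div l + 1) choose 2) + (l - q) * (((n - q) div l) choose 2)"
proof -
  have k: "k > 0" and l: "l > 0" using assms(1) by (auto simp: l_def)
  have "book_crossing_Kmn k (k + 1) n = (\<Sum>i<n. i div l)"
    by (rule book_crossing_eq[OF k l_def[THEN meta_eq_to_obj_eq]])
      (use forbidden_gap_lists[OF assms(1)] in \<open>simp add: l_def\<close>)
  moreover have "(n - q) div l = n div l" using l by (simp add: q_def minus_mod_eq_mult_div)
  ultimately show ?thesis using sum_div_eq_choose[OF l, of n] by (simp add: q_def)
qed

end
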